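(* Let $k$ be a field, $S=k[x_1,x_2,x_3]$, and let $N=\bigoplus_{i=1}^{r} S/(x_1,x_2,x_3^{n_i})$ for some positive integers $n_1,\dots,n_r$. Let $I\subseteq K\subseteq S$ and $J\subseteq L\subseteq S$ be monomial ideals with $\dim_k S/I<\infty$ and $\dim_k S/J<\infty$, such that $K/I\cong N$ as $S$-modules, and let $\phi\colon K/I\to L/J$ be an isomorphism of $S$-modules sending monomials to monomials. Put \[ M=(S/I\oplus S/J)\big/\langle (f,-\phi(f)) \mid f\in K/I\rangle , \] let $d=\dim_k M$, let $A_i$ ($i=1,2,3$) be the $d\times d$ matrix of the $k$-linear map $M\to M$, $m\mapsto x_i m$, with respect to the natural monomial basis of $M$, and let $\mathcal{A}$ be the unital $k$-algebra generated by $A_1,A_2,A_3$. Then $\dim_k\mathcal{A}\le d$.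
   Context: An $S$-module isomorphism $\phi\colon K/I\to L/J$ "sends monomials to monomials" if for every monomial $x^a\in K\setminus I$, the image under $\phi$ of the class of $x^a$ is the class of some monomial $x^{a'}\in L\setminus J$. The natural monomial basis of $M$ consists of the images of the classes of monomials of $S/I$ and $S/J$ (with identified monomials counted once). The matrices $A_i$ pairwise commute. *)

theory Defs
  imports Complex_Main "HOL-Library.Function_Algebras"
begin

(* Monomials of S = k[x1,x2,x3] are represented by exponent triples.
   The variables x1,x2,x3 are indexed by i = 0,1,2. *)
type_synonym expo = "nat \<times> nat \<times> nat"

definition eadd :: "expo \<Rightarrow> expo \<Rightarrow> expo" where
  "eadd a b = (fst a + fst b, fst (snd a) + fst (snd b), snd (snd a) + snd (snd b))"

definition evar :: "nat \<Rightarrow> expo" where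
  "evar i = (if i = 0 then (1,0,0) else if i = 1 then (0,1,0) else (0,0,1))"

(* A monomial ideal is represented by the set of exponents of the monomials it
   contains; this set is closed under multiplication by monomials. *)
definition monomial_ideal :: "expo set \<Rightarrow> bool" where
  "monomial_ideal I \<longleftrightarrow> (\<forall>a\<in>I. \<forall>c. eadd a c \<in> I)"

definition mon_ideal_gen :: "expo set \<Rightarrow> expo set" where
  "mon_ideal_gen G = {a. \<exists>g\<in>G. \<exists>c. a = eadd g c}"

definition vecs :: "'b set \<Rightarrow> ('b \<Rightarrow> 'k::zero) set" where
  "vecs B = {v. \<forall>x. x \<notin> B \<longrightarrow> v x = 0}"

definition delta :: "'b \<Rightarrow> 'b \<Rightarrow> 'k::{zero,one}" where
  "delta x = (\<lambda>y. if y = x then 1 else 0)"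

(* multiplication by x_i on S/I (and on submodules K/I), in the monomial basis of
   standard monomials (those not in I): x_i * sum v_a x^a = sum v_a x^(a+e_i) mod I *)
definition mulx :: "expo set \<Rightarrow> nat \<Rightarrow> (expo \<Rightarrow> 'k::comm_ring_1) \<Rightarrow> expo \<Rightarrow> 'k" where
  "mulx I i v = (\<lambda>b. if b \<in> I then 0 else (\<Sum>a\<in>{a. eadd a (evar i) = b}. v a))"

(* S-module homomorphisms / isomorphisms between modules given by a basis set and
   the actions of x_1,x_2,x_3 (S-linear = k-linear and commuting with each x_i) *)
definition smod_hom ::
  "'b set \<Rightarrow> (nat \<Rightarrow> ('b \<Rightarrow> 'k::field) \<Rightarrow> ('b \<Rightarrow> 'k)) \<Rightarrow>
   'c set \<Rightarrow> (nat \<Rightarrow> ('c \<Rightarrow> 'k) \<Rightarrow> ('c \<Rightarrow> 'k)) \<Rightarrow>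
   (('b \<Rightarrow> 'k) \<Rightarrow> ('c \<Rightarrow> 'k)) \<Rightarrow> bool" where
  "smod_hom B X C Y T \<longleftrightarrow>
     (\<forall>v\<in>vecs B. T v \<in> vecs C) \<and>
     (\<forall>u\<in>vecs B. \<forall>v\<in>vecs B. T (\<lambda>x. u x + v x) = (\<lambda>y. T u y + T v y)) \<and>
     (\<forall>c. \<forall>v\<in>vecs B. T (\<lambda>x. c * v x) = (\<lambda>y. c * T v y)) \<and>
     (\<forall>i<3. \<forall>v\<in>vecs B. T (X i v) = Y i (T v))"

definition smod_iso ::
  "'b set \<Rightarrow> (nat \<Rightarrow> ('b \<Rightarrow> 'k::field) \<Rightarrow> ('b \<Rightarrow> 'k)) \<Rightarrow>
   'c set \<Rightarrow> (nat \<Rightarrow> ('c \<Rightarrow> 'k) \<Rightarrow> ('c \<Rightarrow> 'k)) \<Rightarrow>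
   (('b \<Rightarrow> 'k) \<Rightarrow> ('c \<Rightarrow> 'k)) \<Rightarrow> bool" where
  "smod_iso B X C Y T \<longleftrightarrow> smod_hom B X C Y T \<and> bij_betw T (vecs B) (vecs C)"

definition Pideal :: "nat \<Rightarrow> expo set" where
  "Pideal n = mon_ideal_gen {(1,0,0), (0,1,0), (0,0,n)}"

definition Nbasis :: "nat list \<Rightarrow> (nat \<times> expo) set" where
  "Nbasis ns = {(j,a). j < length ns \<and> a \<notin> Pideal (ns ! j)}"

definition Nop :: "nat list \<Rightarrow> nat \<Rightarrow> (nat \<times> expo \<Rightarrow> 'k::comm_ring_1) \<Rightarrow> nat \<times> expo \<Rightarrow> 'k" where
  "Nop ns i v = (\<lambda>(j,b). if j < length ns then mulx (Pideal (ns ! j)) i (\<lambda>a. v (j,a)) b else 0)"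

(* S/I (+) S/J : coordinates indexed by Inl a (a not in I) and Inr b (b not in J) *)
definition pairv :: "(expo \<Rightarrow> 'k) \<Rightarrow> (expo \<Rightarrow> 'k) \<Rightarrow> (expo + expo \<Rightarrow> 'k)" where
  "pairv f g = (\<lambda>s. case s of Inl a \<Rightarrow> f a | Inr b \<Rightarrow> g b)"

definition Sbasis :: "expo set \<Rightarrow> expo set \<Rightarrow> (expo + expo) set" where
  "Sbasis I J = Inl ` (- I) \<union> Inr ` (- J)"

definition Sop :: "expo set \<Rightarrow> expo set \<Rightarrow> nat \<Rightarrow> (expo + expo \<Rightarrow> 'k::comm_ring_1) \<Rightarrow> expo + expo \<Rightarrow> 'k" where
  "Sop I J i w = pairv (mulx I i (\<lambda>a. w (Inl a))) (mulx J i (\<lambda>b. w (Inr b)))"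

inductive_set submod_gen :: "('b \<Rightarrow> 'k::comm_ring_1) set \<Rightarrow> (nat \<Rightarrow> ('b \<Rightarrow> 'k) \<Rightarrow> ('b \<Rightarrow> 'k)) \<Rightarrow> ('b \<Rightarrow> 'k) set"
  for G X where
  gen: "g \<in> G \<Longrightarrow> g \<in> submod_gen G X"
| zero: "(\<lambda>_. 0) \<in> submod_gen G X"
| add: "u \<in> submod_gen G X \<Longrightarrow> v \<in> submod_gen G X \<Longrightarrow> (\<lambda>s. u s + v s) \<in> submod_gen G X"
| smult: "u \<in> submod_gen G X \<Longrightarrow> (\<lambda>s. c * u s) \<in> submod_gen G X"
| mulx: "i < 3 \<Longrightarrow> u \<in> submod_gen G X \<Longrightarrow> X i u \<in> submod_gen G X"

definition Usub :: "expo set \<Rightarrow> expo set \<Rightarrow> expo set \<Rightarrow> ((expo \<Rightarrow> 'k::field) \<Rightarrow> (expo \<Rightarrow> 'k)) \<Rightarrow> (expo + expo \<Rightarrow> 'k) set" where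
  "Usub I J K phi = submod_gen {pairv f (\<lambda>b. - phi f b) | f. f \<in> vecs (K - I)} (Sop I J)"

definition Mcls :: "expo set \<Rightarrow> expo set \<Rightarrow> expo set \<Rightarrow> ((expo \<Rightarrow> 'k::field) \<Rightarrow> (expo \<Rightarrow> 'k)) \<Rightarrow> (expo + expo \<Rightarrow> 'k) \<Rightarrow> (expo + expo \<Rightarrow> 'k) set" where
  "Mcls I J K phi w = {w'. w' \<in> vecs (Sbasis I J) \<and> (\<lambda>s. w' s - w s) \<in> Usub I J K phi}"

(* the natural monomial basis of M: classes of the monomials of S/I and of S/J
   (identified monomials give the same class and are counted once) *)
definition Mbasis :: "expo set \<Rightarrow> expo set \<Rightarrow> expo set \<Rightarrow> ((expo \<Rightarrow> 'k::field) \<Rightarrow> (expo \<Rightarrow> 'k)) \<Rightarrow> (expo + expo \<Rightarrow> 'k) set set" where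
  "Mbasis I J K phi =
     {Mcls I J K phi (delta (Inl a)) | a. a \<notin> I} \<union> {Mcls I J K phi (delta (Inr b)) | b. b \<notin> J}"

definition is_mult_matrix ::
  "expo set \<Rightarrow> expo set \<Rightarrow> expo set \<Rightarrow> ((expo \<Rightarrow> 'k::field) \<Rightarrow> (expo \<Rightarrow> 'k)) \<Rightarrow> nat \<Rightarrow>
   ((expo + expo \<Rightarrow> 'k) set \<Rightarrow> (expo + expo \<Rightarrow> 'k) set \<Rightarrow> 'k) \<Rightarrow> bool" where
  "is_mult_matrix I J K phi i A \<longleftrightarrow>
     (\<forall>\<beta> \<gamma>. (\<beta> \<notin> Mbasis I J K phi \<or> \<gamma> \<notin> Mbasis I J K phi) \<longrightarrow> A \<beta> \<gamma> = 0) \<and>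
     (\<forall>\<gamma>\<in>Mbasis I J K phi. \<forall>w\<in>\<gamma>.
        Mcls I J K phi (Sop I J i w) =
        Mcls I J K phi (\<lambda>s. \<Sum>\<beta>\<in>Mbasis I J K phi. A \<beta> \<gamma> * (SOME v. v \<in> \<beta>) s))"

definition mmul :: "'c set \<Rightarrow> ('c \<Rightarrow> 'c \<Rightarrow> 'k::comm_ring_1) \<Rightarrow> ('c \<Rightarrow> 'c \<Rightarrow> 'k) \<Rightarrow> 'c \<Rightarrow> 'c \<Rightarrow> 'k" where
  "mmul B P Q = (\<lambda>x y. \<Sum>z\<in>B. P x z * Q z y)"

definition mone :: "'c set \<Rightarrow> 'c \<Rightarrow> 'c \<Rightarrow> 'k::comm_ring_1" where
  "mone B = (\<lambda>x y. if x \<in> B \<and> x = y then 1 else 0)"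

inductive_set gen_alg :: "'c set \<Rightarrow> ('c \<Rightarrow> 'c \<Rightarrow> 'k::comm_ring_1) set \<Rightarrow> ('c \<Rightarrow> 'c \<Rightarrow> 'k) set"
  for B G where
  one: "mone B \<in> gen_alg B G"
| gen: "P \<in> G \<Longrightarrow> P \<in> gen_alg B G"
| add: "P \<in> gen_alg B G \<Longrightarrow> Q \<in> gen_alg B G \<Longrightarrow> (\<lambda>x y. P x y + Q x y) \<in> gen_alg B G"
| smult: "P \<in> gen_alg B G \<Longrightarrow> (\<lambda>x y. c * P x y) \<in> gen_alg B G"
| mul: "P \<in> gen_alg B G \<Longrightarrow> Q \<in> gen_alg B G \<Longrightarrow> mmul B P Q \<in> gen_alg B G"

definition mscale :: "'k::field \<Rightarrow> ('c \<Rightarrow> 'c \<Rightarrow> 'k) \<Rightarrow> 'c \<Rightarrow> 'c \<Rightarrow> 'k" where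
  "mscale c P = (\<lambda>x y. c * P x y)"

lemma vector_space_mscale: "vector_space (mscale :: 'k::field \<Rightarrow> ('c \<Rightarrow> 'c \<Rightarrow> 'k) \<Rightarrow> _)"
  by unfold_locales (auto simp: mscale_def fun_eq_iff algebra_simps)

end

theory Submission
  imports Defs "HOL-Library.Multiset"
begin

text \<open>
  Let \<open>\<I>\<close>, \<open>\<J>\<close> be the standard monomials of \<open>S/I\<close>, \<open>S/J\<close>. Since \<open>S/I\<close> and \<open>S/J\<close> embed in \<open>M\<close> and generate it,
  the algebra is \<open>S/(I \<inter> J)\<close>, of dimension \<open>|\<I>| + |\<J>| - |\<I> \<inter> \<J>|\<close>, while \<open>d = |\<I>| + |\<J>| - |K - I|\<close>. So
  the claim is \<open>|K - I| \<le> |\<I> \<inter> \<J>|\<close>. Let \<open>f(p,q)\<close> and \<open>u(p,q)\<close> count the cells of \<open>\<I>\<close> and of \<open>K - I\<close> in the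
  column over \<open>(p,q)\<close>, and \<open>g\<close>, \<open>v\<close> those of \<open>\<J>\<close> and \<open>L - J\<close>. As \<open>x\<^sub>1\<close> and \<open>x\<^sub>2\<close> kill \<open>K/I\<close>,
  \<open>u(p,q) + f(p+1,q) \<le> f(p,q)\<close> and \<open>u(p,q) + f(p,q+1) \<le> f(p,q)\<close>; the isomorphism makes the multisets of
  values of \<open>u\<close> and \<open>v\<close> agree, and one has to show \<open>\<Sum>u \<le> \<Sum>min f g\<close>.

  Take a counterexample minimizing \<open>\<Sum>f + \<Sum>g\<close>. Where \<open>u > 0\<close> one has \<open>g < f\<close> (otherwise lower \<open>f\<close>, \<open>u\<close> there by one,
  and \<open>g\<close>, \<open>v\<close> at a point of equal weight), and symmetrically; so \<open>u\<close> and \<open>v\<close> have disjoint supports. If the support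
  of \<open>g\<close> lay in that of \<open>f\<close>, one could remove the bottom layer of \<open>f\<close> and one cell at each point of the support of \<open>v\<close>.
  Hence neither of the supports of \<open>f\<close> and \<open>g\<close>, which are Young diagrams, contains the other. Sliding weights towards
  the axes shows that the top of each column and the end of each row of the support of \<open>f\<close> carries positive \<open>u\<close>, and
  likewise for \<open>g\<close>. Where the two boundaries cross, a point carries both \<open>u\<close> and \<open>v\<close>, a contradiction.
\<close>

subsection \<open>An inequality for pairs of plane partitions\<close>

text \<open>\<open>f\<close> gives the column heights of a plane partition over \<open>F\<close>;
  the top \<open>u (p, q)\<close> cells of a column rise above both neighbouring columns, so
  \<open>x_1\<close> and \<open>x_2\<close> push them out.\<close>

definition carries :: "(nat \<times> nat) set \<Rightarrow> (nat \<times> nat \<Rightarrow> nat) \<Rightarrow> (nat \<times> nat \<Rightarrow> nat) \<Rightarrow> bool" where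
  "carries F f u \<longleftrightarrow> (\<forall>x. x \<notin> F \<longrightarrow> f x = 0) \<and>
     (\<forall>p q. u (p, q) + f (Suc p, q) \<le> f (p, q) \<and> u (p, q) + f (p, Suc q) \<le> f (p, q))"

text \<open>Both multisets run over the same \<open>F\<close> and include zero weights, so a weight
  may be moved to a point of weight zero.\<close>

definition counterexample where
  "counterexample F f u g v \<longleftrightarrow> carries F f u \<and> carries F g v \<and>
     image_mset u (mset_set F) = image_mset v (mset_set F) \<and>
     (\<Sum>x\<in>F. min (f x) (g x)) < sum u F"

lemma carriesD:
  assumes "carries F f u"
  shows "x \<notin> F \<Longrightarrow> f x = 0"
    and "u (p, q) + f (Suc p, q) \<le> f (p, q)" and "u (p, q) + f (p, Suc q) \<le> f (p, q)"
  using assms unfolding carries_def by blast+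

lemma carries_le: "carries F f u \<Longrightarrow> u x \<le> f x"
  by (cases x) (metis carriesD(2) add_leD1)

lemma carries_antimono:
  assumes "carries F f u" "p \<le> p'" "q \<le> q'"
  shows "f (p', q') \<le> f (p, q)"
proof -
  have "f (p', q') \<le> f (p, q')"
    using assms(2) by (induction rule: dec_induct)
      (auto intro: order.trans[OF add_leD2[OF carriesD(2)[OF assms(1)]]])
  also have "\<dots> \<le> f (p, q)"
    using assms(3) by (induction rule: dec_induct)
      (auto intro: order.trans[OF add_leD2[OF carriesD(3)[OF assms(1)]]])
  finally show ?thesis .
qed

lemma counterexample_swap: "counterexample F f u g v \<Longrightarrow> counterexample F g v f u"
  unfolding counterexample_def
  by (metis (no_types, lifting) min.commute sum.cong sum_unfold_sum_mset)

lemma image_mset_fun_upd: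
  assumes "finite F" "y \<in> F"
  shows "image_mset (u(y := n)) (mset_set F) = add_mset n (image_mset u (mset_set F) - {#u y#})"
proof -
  have "mset_set F = add_mset y (mset_set (F - {y}))"
    using assms by (metis mset_set.remove)
  moreover have "image_mset (u(y := n)) (mset_set (F - {y})) = image_mset u (mset_set (F - {y}))"
    by (rule image_mset_cong) (use assms in auto)
  ultimately show ?thesis by simp
qed

section \<open>Reductions of a minimal counterexample\<close>

locale minimal_counterexample =
  fixes F :: "(nat \<times> nat) set" and f u g v
  assumes fin: "finite F"
    and cex: "counterexample F f u g v"
    and minimal: "counterexample F f' u' g' v' \<Longrightarrow> sum f F + sum g F \<le> sum f' F + sum g' F"
begin

lemma swap: "minimal_counterexample F g v f u"
  by unfold_locales (use fin cex minimal counterexample_swap in \<open>auto simp: add.commute\<close>)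

lemma car_f: "carries F f u" and car_g: "carries F g v"
  and same_weights: "image_mset u (mset_set F) = image_mset v (mset_set F)"
  and exceeds: "(\<Sum>x\<in>F. min (f x) (g x)) < sum u F"
  using cex unfolding counterexample_def by auto

lemma smaller:
  assumes "carries F f' u'" "carries F g' v'"
    and "image_mset u' (mset_set F) = image_mset v' (mset_set F)"
    and "sum f' F + sum g' F < sum f F + sum g F"
  shows "sum u' F \<le> (\<Sum>x\<in>F. min (f' x) (g' x))"
  using minimal[of f' u' g' v'] assms unfolding counterexample_def by fastforce

text \<open>Lowering \<open>f\<close> cannot raise the sum of minima, and rearranging
  \<open>u\<close> keeps its total, so a smaller counterexample would result.\<close>

lemma no_free_reduction:
  assumes "carries F f' u'" "image_mset u' (mset_set F) = image_mset u (mset_set F)"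
    and le: "\<And>x. f' x \<le> f x" and "f' y < f y"
  shows False
proof -
  have y: "y \<in> F" using assms(4) carriesD(1)[OF car_f, of y] by fastforce
  have "sum f' F < sum f F"
    by (rule sum_strict_mono_ex1) (use fin le y assms(4) in auto)
  then have "sum u' F \<le> (\<Sum>x\<in>F. min (f' x) (g x))"
    by (intro smaller[OF assms(1) car_g]) (use assms(2) same_weights in auto)
  also have "\<dots> \<le> (\<Sum>x\<in>F. min (f x) (g x))"
    by (intro sum_mono min.mono le order.refl)
  also have "\<dots> < sum u F" by (rule exceeds)
  also have "sum u F = sum u' F" using assms(2) by (simp add: sum_unfold_sum_mset)
  finally show False by simp
qed

text \<open>Any slack could be cut off the column without touching \<open>u\<close>.\<close>

lemma height_eq: "f (p, q) = u (p, q) + max (f (Suc p, q)) (f (p, Suc q))"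
proof (rule ccontr)
  assume "\<not> ?thesis"
  then have less: "u (p, q) + max (f (Suc p, q)) (f (p, Suc q)) < f (p, q)"
    using carriesD(2,3)[OF car_f, of p q] by auto
  let ?f = "f((p, q) := u (p, q) + max (f (Suc p, q)) (f (p, Suc q)))"
  have "carries F ?f u"
    unfolding carries_def
  proof (intro conjI allI impI)
    fix x assume "x \<notin> F" then show "?f x = 0"
      using less carriesD(1)[OF car_f, of x] by auto
  next
    fix a b
    show "u (a, b) + ?f (Suc a, b) \<le> ?f (a, b)" "u (a, b) + ?f (a, Suc b) \<le> ?f (a, b)"
      using less carriesD(2,3)[OF car_f, of a b] by auto
  qed
  then show False
    by (rule no_free_reduction[where y = "(p, q)"]) (use less in auto)
qed

text \<open>If \<open>f y \<le> g y\<close>, cutting one cell from \<open>f\<close> and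
  \<open>u\<close> at \<open>y\<close> lowers the total weight by exactly one and the sum of minima
  by at least one. The smaller pair satisfies the inequality, hence so would the original.\<close>

lemma weight_imp_less:
  assumes "u y > 0" shows "g y < f y"
proof (rule ccontr)
  assume nless: "\<not> g y < f y"
  have fy: "f y > 0" using carries_le[OF car_f, of y] assms by linarith
  then have y: "y \<in> F" using carriesD(1)[OF car_f, of y] by fastforce
  then have "u y \<in># image_mset v (mset_set F)"
    using fin by (simp flip: same_weights)
  \<comment> \<open>Any point with \<open>v z = u y\<close> will do: the same value is then lowered
    by one in both multisets.\<close>
  then obtain z where z: "z \<in> F" "v z = u y" using fin by auto
  have gz: "g z > 0" using carries_le[OF car_g, of z] assms z by linarith
  let ?f = "f(y := f y - 1)" and ?u = "u(y := u y - 1)"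
  let ?g = "g(z := g z - 1)" and ?v = "v(z := v z - 1)"
  have carries_dec: "carries F (h(x := h x - 1)) (w(x := w x - 1))"
    if "carries F h w" "w x > 0" for h w x
    unfolding carries_def
  proof (intro conjI allI impI)
    fix y assume "y \<notin> F" then show "(h(x := h x - 1)) y = 0"
      using carriesD(1)[OF that(1), of y] by auto
  next
    fix a b
    show "(w(x := w x - 1)) (a, b) + (h(x := h x - 1)) (Suc a, b) \<le> (h(x := h x - 1)) (a, b)"
      "(w(x := w x - 1)) (a, b) + (h(x := h x - 1)) (a, Suc b) \<le> (h(x := h x - 1)) (a, b)"
      using carriesD(2,3)[OF that(1), of a b] that(2) by auto
  qed
  have sf: "sum f F = Suc (sum ?f F)" and su: "sum u F = Suc (sum ?u F)"
    using fin y fy assms by (auto simp: sum.remove[of F y])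
  have "sum ?g F \<le> sum g F" by (intro sum_mono) auto
  then have "sum ?u F \<le> (\<Sum>x\<in>F. min (?f x) (?g x))"
    using assms z y fin same_weights sf
    by (intro smaller[where v' = ?v] carries_dec car_f car_g)
      (simp_all add: image_mset_fun_upd del: fun_upd_apply)
  also have "\<dots> < (\<Sum>x\<in>F. min (f x) (g x))"
    by (rule sum_strict_mono_ex1) (use fin y fy nless in \<open>auto intro!: bexI[of _ y]\<close>)
  finally show False using exceeds su by linarith
qed

text \<open>All positive weights drop by one on both sides, so the multisets stay equal and the
  total weight drops by the number of points with \<open>v > 0\<close>. The minimum drops at each of
  these points too, which gives the inequality for the original pair.\<close>

lemma support_not_subset: "\<not> (\<forall>x. g x > 0 \<longrightarrow> f x > 0)"
proof
  assume sub: "\<forall>x. g x > 0 \<longrightarrow> f x > 0"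
  interpret sw: minimal_counterexample F g v f u by (rule swap)
  let ?V = "{x \<in> F. v x > 0}"
  let ?f = "\<lambda>x. f x - 1" and ?u = "\<lambda>x. u x - 1"
  let ?g = "\<lambda>x. if v x > 0 then g x - 1 else g x" and ?v = "\<lambda>x. v x - 1"
  have cf: "carries F ?f ?u"
    unfolding carries_def
  proof (intro conjI allI impI)
    fix a b
    show "?u (a, b) + ?f (Suc a, b) \<le> ?f (a, b)" "?u (a, b) + ?f (a, Suc b) \<le> ?f (a, b)"
      using carriesD(2,3)[OF car_f, of a b] by linarith+
  qed (simp add: carriesD(1)[OF car_f])
  have cg: "carries F ?g ?v"
    unfolding carries_def
  proof (intro conjI allI impI)
    fix a b
    show "?v (a, b) + ?g (Suc a, b) \<le> ?g (a, b)" "?v (a, b) + ?g (a, Suc b) \<le> ?g (a, b)"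
      using carriesD(2,3)[OF car_g, of a b] by auto
  qed (simp add: carriesD(1)[OF car_g])
  have dec: "sum w F = sum (\<lambda>x. w x - 1) F + card {x \<in> F. w x > 0}" for w :: "nat \<times> nat \<Rightarrow> nat"
  proof -
    have "sum w F = (\<Sum>x\<in>F. (w x - 1) + of_bool (w x > 0))"
      by (intro sum.cong) auto
    then show ?thesis using fin by (simp add: sum.distrib Int_def)
  qed
  have wts: "image_mset ?u (mset_set F) = image_mset ?v (mset_set F)"
    using arg_cong[OF same_weights, of "image_mset (\<lambda>n. n - 1)"]
    by (simp add: multiset.map_comp o_def)
  have cards: "card {x \<in> F. u x > 0} = card ?V"
  proof -
    have "size (filter_mset (\<lambda>n. n > 0) (image_mset w (mset_set F))) = card {x \<in> F. w x > 0}"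
      for w :: "nat \<times> nat \<Rightarrow> nat"
      using fin by (simp add: filter_mset_image_mset)
    then show ?thesis using same_weights by metis
  qed
  have "sum u F > 0" using exceeds by linarith
  then obtain y where "y \<in> F" "u y > 0" by (metis gr0I less_numeral_extra(3) sum.neutral)
  then have "f y > 0" using carries_le[OF car_f, of y] by linarith
  have "sum ?f F < sum f F"
    by (rule sum_strict_mono_ex1) (use fin \<open>y \<in> F\<close> \<open>f y > 0\<close> in \<open>auto intro!: bexI[of _ y]\<close>)
  moreover have "sum ?g F \<le> sum g F" by (intro sum_mono) auto
  ultimately have *: "sum ?u F \<le> (\<Sum>x\<in>F. min (?f x) (?g x))"
    by (intro smaller[OF cf cg wts]) linarith
  have "(\<Sum>x\<in>F. min (?f x) (?g x)) + card ?V = (\<Sum>x\<in>F. min (?f x) (?g x) + of_bool (v x > 0))"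
    using fin by (simp add: sum.distrib Int_def)
  also have "\<dots> \<le> (\<Sum>x\<in>F. min (f x) (g x))"
  proof (rule sum_mono)
    fix x assume "x \<in> F"
    \<comment> \<open>Where \<open>v x > 0\<close>, the mirrored \<open>weight_imp_less\<close>
      makes \<open>f x\<close> the minimum, and the assumed inclusion makes it positive, so
      \<open>f x - 1\<close> is not truncated.\<close>
    show "min (?f x) (?g x) + of_bool (v x > 0) \<le> min (f x) (g x)"
      using sw.weight_imp_less[of x] sub[rule_format, of x] by auto
  qed
  finally show False using * exceeds dec[of u] cards by linarith
qed

text \<open>The weight of \<open>y\<close> is swapped with the zero weight of its predecessor
  \<open>y'\<close>, and \<open>u y\<close> cells are dropped at \<open>y\<close>. There is room at
  \<open>y'\<close>: towards \<open>y\<close> because \<open>f y \<le> f y'\<close>, in the other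
  direction because the neighbour has height 0.\<close>

lemma no_free_move:
  assumes y: "u y > 0" and y': "u y' = 0" "y' \<in> F"
    and room: "\<And>p q. (p, q) = y' \<Longrightarrow> y = (Suc p, q) \<and> f (p, Suc q) = 0 \<or> y = (p, Suc q) \<and> f (Suc p, q) = 0"
  shows False
proof -
  have yF: "y \<in> F" using y carries_le[OF car_f, of y] carriesD(1)[OF car_f, of y] by fastforce
  let ?f = "f(y := f y - u y)" and ?u = "u \<circ> (id(y := y', y' := y))"
  have neq: "y \<noteq> y'" using y y' by auto
  have "carries F ?f ?u"
    unfolding carries_def
  proof (intro conjI allI impI)
    fix x assume "x \<notin> F" then show "?f x = 0" using carriesD(1)[OF car_f, of x] by auto
  next
    fix a b
    note * = carriesD(2,3)[OF car_f, of a b] carries_le[OF car_f, of y] room[of a b] y' neq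
    show "?u (a, b) + ?f (Suc a, b) \<le> ?f (a, b)"
      using * by (cases "(a, b) = y'"; cases "(a, b) = y"; auto)
    show "?u (a, b) + ?f (a, Suc b) \<le> ?f (a, b)"
      using * by (cases "(a, b) = y'"; cases "(a, b) = y"; auto)
  qed
  moreover have "image_mset ?u (mset_set F) = image_mset u (mset_set F)"
  proof -
    have inj: "inj_on (id(y := y', y' := y)) F" by (auto simp: inj_on_def split: if_splits)
    moreover have "(id(y := y', y' := y)) ` F = F" using yF y'(2) neq
      by (auto simp: image_iff split: if_splits)
    ultimately show ?thesis
      by (metis image_mset_mset_set multiset.map_comp)
  qed
  ultimately show False
    by (rule no_free_reduction[where y = y]) (use y carries_le[OF car_f, of y] in auto)
qed

text \<open>Descending induction on \<open>p\<close> from the far end of the support. If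
  \<open>(n, q)\<close> had weight zero, \<open>height_eq\<close> would give
  \<open>(Suc n, q)\<close> positive height, hence by induction a weight that
  \<open>no_free_move\<close> could slide to \<open>(n, q)\<close>.\<close>

lemma column_top:
  assumes "f (p, q) > 0" "f (p, Suc q) = 0"
  shows "u (p, q) > 0"
proof -
  have "finite ((\<lambda>p. (p, q)) -` F)" using fin by (intro finite_vimageI) (auto simp: inj_def)
  then obtain N where N: "\<And>p. (p, q) \<in> F \<Longrightarrow> p \<le> N"
    unfolding finite_nat_set_iff_bounded_le by blast
  then have "p \<le> N" using assms(1) carriesD(1)[OF car_f, of "(p, q)"] by fastforce
  then show ?thesis using assms
  proof (induction rule: inc_induct)
    case base
    have "f (Suc N, q) = 0" using N[of "Suc N"] carriesD(1)[OF car_f] by fastforce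
    then show ?case using height_eq[of N q] base by simp
  next
    case (step n)
    show ?case
    proof (rule ccontr)
      assume n: "\<not> u (n, q) > 0"
      then have pos: "f (Suc n, q) > 0" using height_eq[of n q] step.prems by simp
      moreover have "f (Suc n, Suc q) = 0"
        using carries_antimono[OF car_f, of n "Suc n" "Suc q" "Suc q"] step.prems by simp
      ultimately have "u (Suc n, q) > 0" by (rule step.IH)
      moreover have "(n, q) \<in> F" using step.prems carriesD(1)[OF car_f, of "(n, q)"] by fastforce
      ultimately show False using no_free_move[of "(Suc n, q)" "(n, q)"] n step.prems by auto
    qed
  qed
qed

text \<open>Mirror image of \<open>column_top\<close>, with the coordinates exchanged.\<close>

lemma row_end:
  assumes "f (p, q) > 0" "f (Suc p, q) = 0"
  shows "u (p, q) > 0"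
proof -
  have "finite ((\<lambda>q. (p, q)) -` F)" using fin by (intro finite_vimageI) (auto simp: inj_def)
  then obtain N where N: "\<And>q. (p, q) \<in> F \<Longrightarrow> q \<le> N"
    unfolding finite_nat_set_iff_bounded_le by blast
  then have "q \<le> N" using assms(1) carriesD(1)[OF car_f, of "(p, q)"] by fastforce
  then show ?thesis using assms
  proof (induction rule: inc_induct)
    case base
    have "f (p, Suc N) = 0" using N[of "Suc N"] carriesD(1)[OF car_f] by fastforce
    then show ?case using height_eq[of p N] base by simp
  next
    case (step n)
    show ?case
    proof (rule ccontr)
      assume n: "\<not> u (p, n) > 0"
      then have pos: "f (p, Suc n) > 0" using height_eq[of p n] step.prems by simp
      moreover have "f (Suc p, Suc n) = 0"
        using carries_antimono[OF car_f, of "Suc p" "Suc p" n "Suc n"] step.prems by simp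
      ultimately have "u (p, Suc n) > 0" by (rule step.IH)
      moreover have "(p, n) \<in> F" using step.prems carriesD(1)[OF car_f, of "(p, n)"] by fastforce
      ultimately show False using no_free_move[of "(p, Suc n)" "(p, n)"] n step.prems by auto
    qed
  qed
qed

text \<open>Some column \<open>a\<close> before \<open>p'\<close> is strictly taller in the support
  of \<open>f\<close> than in that of \<open>g\<close>, while column \<open>Suc a\<close> is not.
  Near the top of the \<open>g\<close>-column over \<open>a\<close> lies a boundary point of both
  supports; it carries both \<open>u\<close> and \<open>v\<close>, which
  \<open>weight_imp_less\<close> and its mirror forbid.\<close>

lemma supports_not_crossing:
  assumes fx: "f (p, q) > 0" "g (p, q) = 0" and gx: "g (p', q') > 0" "f (p', q') = 0" and "p < p'"
  shows False
proof -
  interpret sw: minimal_counterexample F g v f u by (rule swap)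
  define taller where "taller a \<longleftrightarrow> (\<exists>b. f (a, b) > 0 \<and> g (a, b) = 0)" for a
  have "taller p" unfolding taller_def using fx by blast
  moreover have ntall: "\<not> taller p'"
    unfolding taller_def
  proof clarify
    fix b assume "f (p', b) > 0" "g (p', b) = 0"
    then show False
      using carries_antimono[OF car_g, of p' p' b q'] carries_antimono[OF car_f, of p' p' q' b] gx
      by (cases "b \<le> q'") auto
  qed
  ultimately obtain a where a: "taller a" "\<not> taller (Suc a)" "a < p'"
  proof -
    have "\<exists>a. taller a \<and> \<not> taller (Suc a) \<and> a < p'"
    proof (rule ccontr)
      assume *: "\<not> ?thesis"
      have "taller p'" using \<open>p < p'\<close>[THEN less_imp_le]
      proof (induction rule: dec_induct)
        case base show ?case by fact
      next
        case (step n) then show ?case using * by blast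
      qed
      then show False using ntall by simp
    qed
    then show ?thesis using that by blast
  qed
  obtain c where c: "f (a, c) > 0" "g (a, c) = 0" using a unfolding taller_def by blast
  \<comment> \<open>Top of column \<open>a\<close> in the support of \<open>g\<close>; this column
    is nonempty because \<open>a < p'\<close>.\<close>
  define b where "b = (LEAST b. g (a, Suc b) = 0)"
  have g0: "g (a, 0) > 0" using carries_antimono[OF car_g, of a p' 0 q'] gx a by simp
  then have "c \<noteq> 0" using c by (cases "c = 0") auto
  then obtain c' where "c = Suc c'" using not0_implies_Suc by blast
  then have least: "g (a, Suc b) = 0" "b \<le> c'"
    unfolding b_def using c by (auto intro: LeastI Least_le)
  have top: "g (a, b) > 0"
  proof (cases b)
    case (Suc b') then show ?thesis using not_less_Least[of b' "\<lambda>b. g (a, Suc b) = 0"] by (auto simp flip: b_def)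
  qed (use g0 in simp)
  have fab: "f (a, b) > 0"
    using carries_antimono[OF car_f, of a a b c] c least \<open>c = Suc c'\<close> by simp
  have common: "\<not> (u x > 0 \<and> v x > 0)" for x
    using weight_imp_less[of x] sw.weight_imp_less[of x] by (meson less_asym)
  show False
  \<comment> \<open>If row \<open>b\<close> of the support of \<open>f\<close> ends at
    \<open>a\<close>, the common boundary point is \<open>(a, b)\<close>; otherwise
    \<open>(Suc a, b)\<close> is the top of both columns over \<open>Suc a\<close>.\<close>
  proof (cases "f (Suc a, b) = 0")
    case True
    then show False using row_end[OF fab] sw.column_top[OF top least(1)] common by blast
  next
    case False
    have "g (Suc a, Suc b) = 0"
      using carries_antimono[OF car_g, of a "Suc a" "Suc b" "Suc b"] least by simp
    moreover from this have "f (Suc a, Suc b) = 0" using a(2) unfolding taller_def by auto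
    moreover have "g (Suc a, b) > 0" using a(2) False unfolding taller_def by (metis gr0I)
    ultimately show False using column_top[of "Suc a" b] sw.column_top[of "Suc a" b] False common by blast
  qed
qed

lemma contradiction: False
proof -
  interpret sw: minimal_counterexample F g v f u by (rule swap)
  obtain p q p' q' where *: "f (p, q) > 0" "g (p, q) = 0" "g (p', q') > 0" "f (p', q') = 0"
    using support_not_subset sw.support_not_subset by (metis gr0I surj_pair)
  consider "p < p'" | "p' < p" | "p = p'" by linarith
  then show False
  proof cases
    \<comment> \<open>Within one column the two supports are initial segments, hence nested.\<close>
    case 3
    then show False
      using carries_antimono[OF car_f, of p p' q' q] carries_antimono[OF car_g, of p p' q q'] *
      by (cases "q \<le> q'") auto
  qed (use supports_not_crossing sw.supports_not_crossing * in blast)+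
qed

end

theorem sum_weights_le:
  assumes "finite F" "carries F f u" "carries F g v"
    and "image_mset u (mset_set F) = image_mset v (mset_set F)"
  shows "sum u F \<le> (\<Sum>x\<in>F. min (f x) (g x))"
proof (rule ccontr)
  assume "\<not> ?thesis"
  then have "counterexample F f u g v" using assms unfolding counterexample_def by auto
  then have "\<exists>w. (case w of (f, u, g, v) \<Rightarrow> counterexample F f u g v) \<and>
      (\<forall>w'. (case w' of (f, u, g, v) \<Rightarrow> counterexample F f u g v) \<longrightarrow>
        (case w of (f, u, g, v) \<Rightarrow> sum f F + sum g F) \<le> (case w' of (f, u, g, v) \<Rightarrow> sum f F + sum g F))"
    by (intro ex_has_least_nat[where k = "(f, u, g, v)"]) simp
  then obtain f u g v where "counterexample F f u g v"
    "\<And>f' u' g' v'. counterexample F f' u' g' v' \<Longrightarrow> sum f F + sum g F \<le> sum f' F + sum g' F"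
    by (clarsimp simp only: split_paired_Ex split_paired_All prod.case)
  then interpret minimal_counterexample F f u g v using assms(1) by unfold_locales
  show False by (rule contradiction)
qed

subsection \<open>Columns of monomial ideals\<close>

definition column :: "expo set \<Rightarrow> nat \<times> nat \<Rightarrow> nat set" where
  "column X x = {t. (fst x, snd x, t) \<in> X}"

lemma mem_column [simp]: "t \<in> column X (p, q) \<longleftrightarrow> (p, q, t) \<in> X"
  by (simp add: column_def)

lemma monomial_idealD:
  "monomial_ideal I \<Longrightarrow> a \<in> I \<Longrightarrow> eadd a c \<in> I"
  "monomial_ideal I \<Longrightarrow> a \<in> I \<Longrightarrow> eadd c a \<in> I"
  unfolding monomial_ideal_def eadd_def by (blast, metis add.commute)

lemma monomial_ideal_mono:
  assumes "monomial_ideal I" "(p, q, t) \<in> I" "t \<le> t'"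
  shows "(p, q, t') \<in> I"
  using monomial_idealD(1)[OF assms(1,2), of "(0, 0, t' - t)"] assms(3) by (simp add: eadd_def)

lemma finite_column:
  assumes "finite X" shows "finite (column X x)"
  unfolding column_def using finite_vimageI[OF assms, of "\<lambda>t. (fst x, snd x, t)"]
  by (simp add: inj_def vimage_def)

text \<open>The standard monomials are closed under division, so each column is an initial segment
  and is determined by its size.\<close>

lemma column_Compl:
  assumes "monomial_ideal I" "finite (- I)"
  shows "column (- I) x = {..<card (column (- I) x)}"
proof (cases "column (- I) x = {}")
  case False
  have fin: "finite (column (- I) x)" by (rule finite_column) fact
  define m where "m = Max (column (- I) x)"
  have "m \<in> column (- I) x" unfolding m_def by (rule Max_in) fact+
  then have "t \<in> column (- I) x" if "t \<le> m" for t
    using monomial_ideal_mono[OF assms(1) _ that, of "fst x" "snd x"] by (auto simp: column_def)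
  then have "column (- I) x = {..m}"
    using Max_ge[OF fin] unfolding m_def by blast
  then show ?thesis by (simp add: lessThan_Suc_atMost)
qed simp

lemma mem_Compl_iff:
  assumes "monomial_ideal I" "finite (- I)"
  shows "(p, q, t) \<in> I \<longleftrightarrow> card (column (- I) (p, q)) \<le> t"
  using arg_cong[OF column_Compl[OF assms, of "(p, q)"], of "\<lambda>A. t \<in> A"]
  by (simp only: mem_column Compl_iff lessThan_iff flip: not_less) blast

lemma card_eq_sum_columns:
  assumes "finite F" "finite X" "\<And>p q t. (p, q, t) \<in> X \<Longrightarrow> (p, q) \<in> F"
  shows "card X = (\<Sum>x\<in>F. card (column X x))"
proof -
  have "card X = card (Sigma F (column X))"
    by (rule bij_betw_same_card[of "\<lambda>(p, q, t). ((p, q), t)"], rule bij_betw_byWitness[where f' = "\<lambda>((p, q), t). (p, q, t)"])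
      (use assms(3) in auto)
  then show ?thesis using assms finite_column by simp
qed

text \<open>A cell of \<open>K - I\<close> enters \<open>I\<close> when moved to the next column, so
  its height does not occur among the standard monomials there. Both sets of heights lie in the
  column over \<open>(p, q)\<close>, so their sizes add.\<close>

lemma carries_columns:
  assumes I: "monomial_ideal I" and K: "monomial_ideal K" and "finite (- I)"
    and F: "\<And>p q t. (p, q, t) \<in> - I \<Longrightarrow> (p, q) \<in> F"
    and ann: "\<And>a. a \<in> K - I \<Longrightarrow> eadd a (1, 0, 0) \<in> I \<and> eadd a (0, 1, 0) \<in> I"
  shows "carries F (\<lambda>x. card (column (- I) x)) (\<lambda>x. card (column (K - I) x))"
proof -
  have fin: "finite (column (- I) x)" for x by (rule finite_column) fact
  have "card (column (K - I) (p, q)) + card (column (- I) x) \<le> card (column (- I) (p, q))"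
    if x: "x = (Suc p, q) \<or> x = (p, Suc q)" for p q x
  proof -
    have "t \<notin> column (- I) x" if "t \<in> column (K - I) (p, q)" for t
      using ann[of "(p, q, t)"] that x by (auto simp: eadd_def)
    then have disj: "column (K - I) (p, q) \<inter> column (- I) x = {}" by blast
    have "(p, q, t) \<notin> I" if "t \<in> column (- I) x" for t
      using monomial_idealD(1)[OF I, of "(p, q, t)" "(1, 0, 0)"]
        monomial_idealD(1)[OF I, of "(p, q, t)" "(0, 1, 0)"] x that by (auto simp: eadd_def)
    then have sub: "column (K - I) (p, q) \<union> column (- I) x \<subseteq> column (- I) (p, q)" by auto
    then have "finite (column (K - I) (p, q))" using fin finite_subset by blast
    then have "card (column (K - I) (p, q)) + card (column (- I) x) =
        card (column (K - I) (p, q) \<union> column (- I) x)"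
      using disj fin by (simp add: card_Un_disjoint)
    also have "\<dots> \<le> card (column (- I) (p, q))" by (rule card_mono[OF fin sub])
    finally show ?thesis .
  qed
  moreover have "column (- I) x = {}" if "x \<notin> F" for x
    using F[of "fst x" "snd x"] that by (cases x) auto
  ultimately show ?thesis unfolding carries_def by (metis card.empty)
qed

text \<open>A column of \<open>K - I\<close> with more than \<open>c\<close> cells has exactly one cell at depth \<open>c\<close> below its top.\<close>

lemma card_columns_gt:
  assumes I: "monomial_ideal I" and K: "monomial_ideal K" and fin: "finite (- I)"
    and F: "\<And>p q t. (p, q, t) \<in> - I \<Longrightarrow> (p, q) \<in> F"
  shows "card {x \<in> F. c < card (column (K - I) x)} =
    card {a \<in> K - I. eadd a (0, 0, c) \<notin> I \<and> eadd a (0, 0, Suc c) \<in> I}"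
proof -
  define h where "h x = card (column (- I) x)" for x
  have memI: "(p, q, t) \<in> I \<longleftrightarrow> h (p, q) \<le> t" for p q t
    unfolding h_def by (rule mem_Compl_iff[OF I fin])
  have gt: "c < card (column (K - I) (p, q)) \<longleftrightarrow> c < h (p, q) \<and> (p, q, h (p, q) - Suc c) \<in> K" for p q
  proof
    assume c: "c < card (column (K - I) (p, q))"
    have "(p, q, h (p, q) - Suc c) \<in> K"
    proof (rule ccontr)
      assume notin: "(p, q, h (p, q) - Suc c) \<notin> K"
      \<comment> \<open>Columns of \<open>K\<close> are closed upward: without the cell at depth
        \<open>c\<close>, at most the \<open>c\<close> cells above it are left.\<close>
      have "column (K - I) (p, q) \<subseteq> {h (p, q) - c..<h (p, q)}"
      proof
        fix t assume t: "t \<in> column (K - I) (p, q)"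
        then have "\<not> t \<le> h (p, q) - Suc c"
          using notin monomial_ideal_mono[OF K, of p q t] by auto
        moreover have "t < h (p, q)" using t by (simp add: memI)
        ultimately show "t \<in> {h (p, q) - c..<h (p, q)}" by auto
      qed
      from card_mono[OF _ this] c show False by simp
    qed
    moreover have "column (K - I) (p, q) \<subseteq> {..<h (p, q)}" by (auto simp: memI)
    from card_mono[OF _ this] c have "c < h (p, q)" by simp
    ultimately show "c < h (p, q) \<and> (p, q, h (p, q) - Suc c) \<in> K" by simp
  next
    assume *: "c < h (p, q) \<and> (p, q, h (p, q) - Suc c) \<in> K"
    then have "{h (p, q) - Suc c..<h (p, q)} \<subseteq> column (K - I) (p, q)"
      using monomial_ideal_mono[OF K] by (auto simp: memI)
    moreover have "finite (column (K - I) (p, q))"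
      by (rule finite_column) (use fin in \<open>auto intro: finite_subset\<close>)
    ultimately have "card {h (p, q) - Suc c..<h (p, q)} \<le> card (column (K - I) (p, q))"
      by (intro card_mono)
    then show "c < card (column (K - I) (p, q))" using * by simp
  qed
  have depth: "eadd (p, q, t) (0, 0, c) \<notin> I \<and> eadd (p, q, t) (0, 0, Suc c) \<in> I \<longleftrightarrow>
      c < h (p, q) \<and> t = h (p, q) - Suc c" for p q t
    by (auto simp: eadd_def memI)
  have "{a \<in> K - I. eadd a (0, 0, c) \<notin> I \<and> eadd a (0, 0, Suc c) \<in> I} =
      (\<lambda>(p, q). (p, q, h (p, q) - Suc c)) ` {x \<in> F. c < card (column (K - I) x)}"
    (is "?A = ?g ` ?B")
  proof (intro equalityI subsetI)
    fix a assume a: "a \<in> ?A"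
    obtain p q t where pqt: "a = (p, q, t)" by (cases a)
    then have "c < h (p, q)" "t = h (p, q) - Suc c" "(p, q, t) \<in> K - I" using a depth[of p q t] by auto
    then have "a = ?g (p, q)" "(p, q) \<in> ?B" using F[of p q t] by (simp_all add: pqt gt)
    then show "a \<in> ?g ` ?B" by (rule image_eqI)
  next
    fix a assume "a \<in> ?g ` ?B"
    then obtain p q where "a = (p, q, h (p, q) - Suc c)" "c < h (p, q)" "a \<in> K" by (auto simp: gt)
    moreover from this have "a \<notin> I" by (simp add: memI)
    ultimately show "a \<in> ?A" using depth[of p q "h (p, q) - Suc c"] by blast
  qed
  moreover have "inj_on ?g ?B" by (auto simp: inj_on_def)
  ultimately show ?thesis by (simp add: card_image)
qed

lemma count_image_mset_set:
  assumes "finite F"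
  shows "count (image_mset w (mset_set F)) c = card {x \<in> F. w x = c}"
proof -
  have "count (image_mset w (mset_set F)) c = (\<Sum>x\<in>{x \<in> F. w x = c}. 1)"
    unfolding count_image_mset by (intro sum.cong) (use assms in auto)
  then show ?thesis by simp
qed

text \<open>\<sigma> matches cells killed by the same powers of \<open>x_3\<close>, hence cells at
  equal depth in their columns. So \<open>K - I\<close> and \<open>L - J\<close> have equally many
  columns of each length, and \<open>sum_weights_le\<close> applies to the column heights.\<close>

lemma card_socle_le:
  assumes mon: "monomial_ideal I" "monomial_ideal K" "monomial_ideal J" "monomial_ideal L"
    and fin: "finite (- I)" "finite (- J)"
    and annI: "\<And>a. a \<in> K - I \<Longrightarrow> eadd a (1, 0, 0) \<in> I \<and> eadd a (0, 1, 0) \<in> I"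
    and annJ: "\<And>a. a \<in> L - J \<Longrightarrow> eadd a (1, 0, 0) \<in> J \<and> eadd a (0, 1, 0) \<in> J"
    and bij: "bij_betw \<sigma> (K - I) (L - J)"
    and hom: "\<And>a c. a \<in> K - I \<Longrightarrow> eadd a (0, 0, c) \<in> I \<longleftrightarrow> eadd (\<sigma> a) (0, 0, c) \<in> J"
  shows "card (K - I) \<le> card (- I \<inter> - J)"
proof -
  define F where "F = (\<lambda>(p, q, t). (p, q)) ` (- I \<union> - J)"
  have F: "finite F" "(p, q, t) \<in> - I \<Longrightarrow> (p, q) \<in> F" "(p, q, t) \<in> - J \<Longrightarrow> (p, q) \<in> F" for p q t
    unfolding F_def using fin by (auto intro: rev_image_eqI[of "(p, q, t)"])
  let ?u = "\<lambda>x. card (column (K - I) x)" and ?v = "\<lambda>x. card (column (L - J) x)"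
  have gt: "card {x \<in> F. c < ?u x} = card {x \<in> F. c < ?v x}" for c
  proof -
    have *: "bij_betw \<sigma> {a \<in> K - I. eadd a (0, 0, c) \<notin> I \<and> eadd a (0, 0, Suc c) \<in> I}
        {a \<in> L - J. eadd a (0, 0, c) \<notin> J \<and> eadd a (0, 0, Suc c) \<in> J}"
      by (rule bij_betw_Collect[OF bij]) (simp add: hom)
    show ?thesis
      using card_columns_gt[OF mon(1,2) fin(1) F(2), where c = c] card_columns_gt[OF mon(3,4) fin(2) F(3), where c = c]
        bij_betw_same_card[OF *] by simp
  qed
  have count: "card {x \<in> F. w x = c} = card {x \<in> F. c \<le> w x} - card {x \<in> F. c < w x}"
    for w :: "nat \<times> nat \<Rightarrow> nat" and c
  proof -
    have "{x \<in> F. w x = c} = {x \<in> F. c \<le> w x} - {x \<in> F. c < w x}" by auto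
    then show ?thesis using F(1) by (simp add: card_Diff_subset Collect_mono)
  qed
  \<comment> \<open>For \<open>c = 0\<close> both sides count all of \<open>F\<close>; otherwise
    this is \<open>gt\<close> at \<open>c - 1\<close>.\<close>
  have "card {x \<in> F. c \<le> ?u x} = card {x \<in> F. c \<le> ?v x}" for c
    using gt[of "c - 1"] by (cases c) (simp_all add: Suc_le_eq)
  then have "card {x \<in> F. ?u x = c} = card {x \<in> F. ?v x = c}" for c
    using gt by (simp add: count)
  then have weights: "image_mset ?u (mset_set F) = image_mset ?v (mset_set F)"
    by (intro multiset_eqI) (simp add: count_image_mset_set F(1))
  have "card (K - I) = sum ?u F"
    by (rule card_eq_sum_columns) (use F finite_subset[OF _ fin(1), of "K - I"] in auto)
  also have "\<dots> \<le> (\<Sum>x\<in>F. min (card (column (- I) x)) (card (column (- J) x)))"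
    by (intro sum_weights_le[OF _ _ _ weights] carries_columns F mon fin annI annJ)
  also have "\<dots> = (\<Sum>x\<in>F. card (column (- I \<inter> - J) x))"
  proof (rule sum.cong)
    fix x
    have "column (- I \<inter> - J) x = column (- I) x \<inter> column (- J) x" by (auto simp: column_def)
    also have "\<dots> = {..<min (card (column (- I) x)) (card (column (- J) x))}"
      using column_Compl[OF mon(1) fin(1), of x] column_Compl[OF mon(3) fin(2), of x] by auto
    finally show "min (card (column (- I) x)) (card (column (- J) x)) = card (column (- I \<inter> - J) x)"
      by simp
  qed simp
  also have "\<dots> = card (- I \<inter> - J)"
    by (rule card_eq_sum_columns[symmetric]) (use F fin in auto)
  finally show ?thesis .
qed

subsection \<open>The glued module and its multiplication algebra\<close>

definition smul :: "expo set \<Rightarrow> expo \<Rightarrow> (expo \<Rightarrow> 'k::comm_ring_1) \<Rightarrow> expo \<Rightarrow> 'k" where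
  "smul I a v = (\<lambda>b. if b \<in> I then 0 else (\<Sum>c\<in>{c. eadd c a = b}. v c))"

lemma eadd_assoc: "eadd (eadd a b) c = eadd a (eadd b c)"
  and eadd_commute: "eadd a b = eadd b a"
  and eadd_zero: "eadd a (0, 0, 0) = a"
  and eadd_cancel: "eadd a c = eadd b c \<longleftrightarrow> a = b"
  by (auto simp: eadd_def prod_eq_iff)

lemma expo_induct [case_names zero add]:
  assumes "P (0, 0, 0)" and step: "\<And>a i. P a \<Longrightarrow> i < 3 \<Longrightarrow> P (eadd a (evar i))"
  shows "P a"
proof -
  have 1: "P (p, 0, 0)" for p
    by (induction p) (use assms(1) step[of _ 0] in \<open>auto simp: eadd_def evar_def\<close>)
  have 2: "P (p, q, 0)" for p q
    by (induction q) (use 1 step[of _ 1] in \<open>auto simp: eadd_def evar_def\<close>)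
  have "P (p, q, t)" for p q t
    by (induction t) (use 2 step[of _ 2] in \<open>auto simp: eadd_def evar_def\<close>)
  then show ?thesis by (cases a) auto
qed

lemma vecsI: "(\<And>x. x \<notin> B \<Longrightarrow> v x = 0) \<Longrightarrow> v \<in> vecs B"
  and vecsD: "v \<in> vecs B \<Longrightarrow> x \<notin> B \<Longrightarrow> v x = 0"
  and vecs_mono: "v \<in> vecs B \<Longrightarrow> B \<subseteq> C \<Longrightarrow> v \<in> vecs C"
  and zero_vecs: "(\<lambda>_. 0) \<in> vecs B"
  unfolding vecs_def by auto

lemma vecs_add: "u \<in> vecs B \<Longrightarrow> v \<in> vecs B \<Longrightarrow> (\<lambda>x. u x + v x) \<in> vecs B"
  and vecs_scale: "v \<in> vecs B \<Longrightarrow> (\<lambda>x. c * v x) \<in> vecs B"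
  for u v :: "'b \<Rightarrow> 'k::comm_ring_1"
  unfolding vecs_def by auto

lemma vecs_sum:
  fixes w :: "'i \<Rightarrow> 'b \<Rightarrow> 'k::comm_ring_1"
  assumes "\<And>i. i \<in> X \<Longrightarrow> w i \<in> vecs B"
  shows "(\<lambda>s. \<Sum>i\<in>X. c i * w i s) \<in> vecs B"
  using assms unfolding vecs_def by (auto intro!: sum.neutral)

lemma delta_vecs: "x \<in> B \<Longrightarrow> delta x \<in> vecs B"
  unfolding vecs_def delta_def by auto

lemma delta_eq_iff: "(delta x :: 'b \<Rightarrow> 'k::zero_neq_one) = delta y \<longleftrightarrow> x = y"
  unfolding delta_def fun_eq_iff by (metis one_neq_zero)

lemma linear_sum:
  fixes T :: "('b \<Rightarrow> 'k::comm_ring_1) \<Rightarrow> ('c \<Rightarrow> 'k)" and w :: "'i \<Rightarrow> 'b \<Rightarrow> 'k"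
  assumes add: "\<And>u v. u \<in> vecs B \<Longrightarrow> v \<in> vecs B \<Longrightarrow> T (\<lambda>x. u x + v x) = (\<lambda>y. T u y + T v y)"
    and scale: "\<And>c v. v \<in> vecs B \<Longrightarrow> T (\<lambda>x. c * v x) = (\<lambda>y. c * T v y)"
    and "finite X" "\<And>i. i \<in> X \<Longrightarrow> w i \<in> vecs B"
  shows "T (\<lambda>s. \<Sum>i\<in>X. c i * w i s) = (\<lambda>y. \<Sum>i\<in>X. c i * T (w i) y)"
  using assms(3,4)
proof (induction X)
  case empty
  show ?case using scale[OF zero_vecs, of 0] by simp
next
  case (insert j X)
  then show ?case
    using add[of "\<lambda>s. c j * w j s" "\<lambda>s. \<Sum>i\<in>X. c i * w i s"] scale[of "w j" "c j"]
    by (simp add: vecs_scale vecs_sum)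
qed

lemma vecs_expand:
  fixes v :: "'b \<Rightarrow> 'k::comm_ring_1"
  assumes "finite B" "v \<in> vecs B"
  shows "v = (\<lambda>s. \<Sum>i\<in>B. v i * delta i s)"
  using assms by (auto simp: fun_eq_iff delta_def vecs_def if_distrib[of "\<lambda>x. _ * x"] cong: if_cong)

lemma mulx_eq_smul: "mulx I i = smul I (evar i)"
  by (simp add: fun_eq_iff mulx_def smul_def)

lemma smul_eadd: "smul I a v (eadd c a) = (if eadd c a \<in> I then 0 else v c)"
  by (simp add: smul_def eadd_cancel)

lemma smul_eq_zero: "\<nexists>c. b = eadd c a \<Longrightarrow> smul I a v b = 0"
  unfolding smul_def by (auto intro!: sum.neutral)

lemma smul_cases:
  obtains c where "b = eadd c a" "smul I a v b = (if b \<in> I then 0 else v c)"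
  | "\<nexists>c. b = eadd c a" "\<And>v. smul I a v b = 0"
  using smul_eadd smul_eq_zero by metis

lemma smul_add: "smul I a (\<lambda>x. u x + v x) = (\<lambda>y. smul I a u y + smul I a v y)"
  and smul_scale: "smul I a (\<lambda>x. c * v x) = (\<lambda>y. c * smul I a v y)"
  and smul_uminus: "smul I a (\<lambda>x. - v x) = (\<lambda>y. - smul I a v y)"
  by (auto simp: smul_def fun_eq_iff sum.distrib sum_distrib_left sum_negf)

lemma smul_one: "v \<in> vecs (- I) \<Longrightarrow> smul I (0, 0, 0) v = v"
  by (auto simp: smul_def fun_eq_iff eadd_zero vecs_def)

text \<open>Reducing modulo \<open>I\<close> between the two factors loses nothing, since multiples
  of monomials in \<open>I\<close> stay in \<open>I\<close>.\<close>

lemma smul_smul: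
  assumes "monomial_ideal I"
  shows "smul I a (smul I b v) = smul I (eadd a b) v"
proof
  fix x
  show "smul I a (smul I b v) x = smul I (eadd a b) v x"
  proof (cases "\<exists>c. x = eadd c (eadd a b)")
    case True
    then obtain c where x: "x = eadd c (eadd a b)" by blast
    then have "x = eadd (eadd c b) a" by (simp add: eadd_def)
    then show ?thesis
      using smul_eadd[of I a "smul I b v" "eadd c b"] smul_eadd[of I b v c]
        smul_eadd[of I "eadd a b" v c] monomial_idealD(1)[OF assms, of "eadd c b" a] x
      by auto
  next
    case False
    show ?thesis
    proof (cases "\<exists>c. x = eadd c a")
      case True
      then obtain c where c: "x = eadd c a" by blast
      then have "\<nexists>d. c = eadd d b" using False by (metis eadd_assoc eadd_commute)
      then show ?thesis using c False smul_eadd[of I a "smul I b v" c] by (simp add: smul_eq_zero)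
    qed (use False in \<open>simp add: smul_eq_zero\<close>)
  qed
qed

lemma smul_vecs:
  assumes "monomial_ideal K" "v \<in> vecs (K - I)"
  shows "smul I a v \<in> vecs (K - I)"
proof (rule vecsI)
  fix x assume x: "x \<notin> K - I"
  show "smul I a v x = 0"
  proof (cases rule: smul_cases[of x a I v])
    case (1 c)
    then show ?thesis
      using x vecsD[OF assms(2), of c] monomial_idealD(1)[OF assms(1), of c a] by auto
  qed
qed

lemma smul_delta: "smul I a (delta c) = (if eadd c a \<in> I then (\<lambda>_. 0) else delta (eadd c a))"
proof
  fix x show "smul I a (delta c) x = (if eadd c a \<in> I then (\<lambda>_. 0) else delta (eadd c a)) x"
    by (cases rule: smul_cases[of x a I "delta c"])
      (auto simp: delta_def eadd_cancel simp del: split_paired_Ex split_paired_All)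
qed

lemma smul_ideal:
  assumes "monomial_ideal I" "a \<in> I" shows "smul I a v = (\<lambda>_. 0)"
proof
  fix x show "smul I a v x = 0"
    using monomial_idealD(2)[OF assms] by (cases rule: smul_cases[of x a I v]) auto
qed

lemma pairv_simps [simp]: "pairv f g (Inl a) = f a" "pairv f g (Inr b) = g b"
  by (simp_all add: pairv_def)

lemma pairv_eqI: "(\<And>a. w (Inl a) = f a) \<Longrightarrow> (\<And>b. w (Inr b) = g b) \<Longrightarrow> w = pairv f g"
  by (rule ext) (simp add: pairv_def split: sum.split)

section \<open>The gluing data and the bijection of monomials induced by \<open>phi\<close>\<close>

locale gluing =
  fixes I K J L :: "expo set" and phi :: "(expo \<Rightarrow> 'k::field) \<Rightarrow> (expo \<Rightarrow> 'k)"
  assumes ideal_I: "monomial_ideal I" and ideal_K: "monomial_ideal K"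
    and ideal_J: "monomial_ideal J" and ideal_L: "monomial_ideal L"
    and I_K: "I \<subseteq> K" and J_L: "J \<subseteq> L"
    and fin_I: "finite (- I)" and fin_J: "finite (- J)"
    and iso: "smod_iso (K - I) (mulx I) (L - J) (mulx J) phi"
    and monomials: "\<forall>a\<in>K - I. \<exists>a'\<in>L - J. phi (delta a) = delta a'"
begin

lemma phi_vecs: "v \<in> vecs (K - I) \<Longrightarrow> phi v \<in> vecs (L - J)"
  and phi_add: "u \<in> vecs (K - I) \<Longrightarrow> v \<in> vecs (K - I) \<Longrightarrow> phi (\<lambda>x. u x + v x) = (\<lambda>y. phi u y + phi v y)"
  and phi_scale: "v \<in> vecs (K - I) \<Longrightarrow> phi (\<lambda>x. c * v x) = (\<lambda>y. c * phi v y)"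
  and phi_mulx: "i < 3 \<Longrightarrow> v \<in> vecs (K - I) \<Longrightarrow> phi (smul I (evar i) v) = smul J (evar i) (phi v)"
  and phi_bij: "bij_betw phi (vecs (K - I)) (vecs (L - J))"
  using iso unfolding smod_iso_def smod_hom_def mulx_eq_smul by blast+

lemma phi_zero: "phi (\<lambda>_. 0) = (\<lambda>_. 0)"
  using phi_scale[OF zero_vecs, of 0] by simp

lemma phi_inj: "phi u = phi v \<Longrightarrow> u \<in> vecs (K - I) \<Longrightarrow> v \<in> vecs (K - I) \<Longrightarrow> u = v"
  using phi_bij unfolding bij_betw_def inj_on_def by blast

lemma phi_smul:
  assumes "v \<in> vecs (K - I)"
  shows "phi (smul I a v) = smul J a (phi v)"
proof (induction a rule: expo_induct)
  case zero
  have "v \<in> vecs (- I)" "phi v \<in> vecs (- J)" using assms phi_vecs[OF assms] by (auto intro: vecs_mono)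
  then show ?case by (simp add: smul_one)
next
  case (add a i)
  have "phi (smul I (evar i) (smul I a v)) = smul J (evar i) (smul J a (phi v))"
    using phi_mulx[OF add(2) smul_vecs[OF ideal_K assms]] add(1) by simp
  then show ?case by (simp add: smul_smul ideal_I ideal_J eadd_commute)
qed

definition \<sigma> :: "expo \<Rightarrow> expo" where
  "\<sigma> a = (SOME a'. a' \<in> L - J \<and> phi (delta a) = delta a')"

lemma \<sigma>: "a \<in> K - I \<Longrightarrow> \<sigma> a \<in> L - J" "a \<in> K - I \<Longrightarrow> phi (delta a) = delta (\<sigma> a)"
  unfolding \<sigma>_def using monomials someI_ex[of "\<lambda>a'. a' \<in> L - J \<and> phi (delta a) = delta a'"] by blast+

text \<open>For surjectivity, a preimage of \<open>delta b\<close> is expanded in monomials: some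
  term contributes at \<open>b\<close>, and the image of its monomial is a single monomial, hence
  \<open>b\<close>.\<close>

lemma \<sigma>_bij: "bij_betw \<sigma> (K - I) (L - J)"
  unfolding bij_betw_def
proof
  show "inj_on \<sigma> (K - I)"
    by (rule inj_onI) (metis \<sigma>(2) delta_eq_iff delta_vecs phi_inj)
  show "\<sigma> ` (K - I) = L - J"
  proof (intro equalityI subsetI)
    fix b assume "b \<in> L - J"
    then have "delta b \<in> phi ` vecs (K - I)"
      using phi_bij delta_vecs[of b "L - J"] by (simp add: bij_betw_def)
    then obtain v where v: "v \<in> vecs (K - I)" "phi v = delta b" by force
    have fin: "finite (K - I)" by (rule finite_subset[OF _ fin_I]) auto
    have "phi (\<lambda>s. \<Sum>a\<in>K - I. v a * delta a s) = (\<lambda>y. \<Sum>a\<in>K - I. v a * phi (delta a) y)"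
      by (rule linear_sum[OF phi_add phi_scale fin delta_vecs])
    then have "phi v b = (\<Sum>a\<in>K - I. v a * phi (delta a) b)"
      by (simp flip: vecs_expand[OF fin v(1)])
    also have "\<dots> = (\<Sum>a\<in>K - I. v a * delta (\<sigma> a) b)" by (simp add: \<sigma>(2))
    finally have "(\<Sum>a\<in>K - I. v a * delta (\<sigma> a) b) \<noteq> 0" using v by (simp add: delta_def)
    then obtain a where "a \<in> K - I" "v a * delta (\<sigma> a) b \<noteq> 0"
      by (rule sum.not_neutral_contains_not_neutral)
    then show "b \<in> \<sigma> ` (K - I)" unfolding delta_def by (auto split: if_splits)
  qed (use \<sigma> in auto)
qed

text \<open>\<open>phi\<close> is injective and commutes with \<open>x^c\<close>, so
  \<open>x^c\<close> kills the class of \<open>x^a\<close> exactly when it kills its image.\<close>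

lemma \<sigma>_eadd:
  assumes a: "a \<in> K - I"
  shows "eadd a c \<in> I \<longleftrightarrow> eadd (\<sigma> a) c \<in> J"
proof -
  have nz: "(delta x :: expo \<Rightarrow> 'k) \<noteq> (\<lambda>_. 0)" for x
    by (metis delta_def one_neq_zero)
  have eq: "phi (smul I c (delta a)) = smul J c (delta (\<sigma> a))"
    using phi_smul[OF delta_vecs[OF a]] \<sigma>(2)[OF a] by simp
  show ?thesis
  proof (cases "eadd a c \<in> I")
    case True
    then show ?thesis using eq nz[of "eadd (\<sigma> a) c"]
      by (auto simp: smul_delta phi_zero split: if_splits)
  next
    case False
    then have "delta (eadd a c) \<in> vecs (K - I)"
      using a monomial_idealD(1)[OF ideal_K, of a c] by (intro delta_vecs) simp
    then have "phi (delta (eadd a c)) \<noteq> (\<lambda>_. 0)"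
      using nz[of "eadd a c"] phi_inj[OF _ _ zero_vecs, of "delta (eadd a c)"] by (auto simp: phi_zero)
    then show ?thesis using eq False by (auto simp: smul_delta split: if_splits)
  qed
qed

section \<open>Normal forms for the elements of \<open>M\<close>\<close>

abbreviation "S \<equiv> Sbasis I J"

definition shift :: "expo \<Rightarrow> (expo + expo \<Rightarrow> 'k) \<Rightarrow> expo + expo \<Rightarrow> 'k" where
  "shift a w = pairv (smul I a (\<lambda>a. w (Inl a))) (smul J a (\<lambda>b. w (Inr b)))"

lemma Sop_eq_shift: "Sop I J i = shift (evar i)"
  by (simp add: fun_eq_iff Sop_def shift_def mulx_eq_smul)

lemma Inl_S [simp]: "Inl a \<in> S \<longleftrightarrow> a \<notin> I" and Inr_S [simp]: "Inr b \<in> S \<longleftrightarrow> b \<notin> J"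
  unfolding Sbasis_def by auto

lemma shift_vecs: "shift a w \<in> vecs S"
proof (rule vecsI)
  fix s assume "s \<notin> S" then show "shift a w s = 0"
    by (cases s) (auto simp: shift_def smul_def)
qed

lemma shift_add: "shift a (\<lambda>s. u s + w s) = (\<lambda>s. shift a u s + shift a w s)"
  and shift_scale: "shift a (\<lambda>s. c * w s) = (\<lambda>s. c * shift a w s)"
  unfolding shift_def smul_add smul_scale by (auto simp: pairv_def split: sum.split)

lemma shift_diff: "shift a (\<lambda>s. u s - w s) = (\<lambda>s. shift a u s - shift a w s)"
  using shift_add[of a u "\<lambda>s. - 1 * w s"] shift_scale[of a "- 1" w] by simp

lemma shift_shift: "shift a (shift b w) = shift (eadd a b) w"
  by (simp add: shift_def smul_smul ideal_I ideal_J)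

lemma shift_one: "w \<in> vecs S \<Longrightarrow> shift (0, 0, 0) w = w"
  unfolding shift_def by (rule pairv_eqI[symmetric]) (simp_all add: smul_one vecs_def)

lemma shift_zero: "a \<in> I \<inter> J \<Longrightarrow> shift a w = (\<lambda>_. 0)"
  unfolding shift_def by (rule pairv_eqI[symmetric]) (simp_all add: smul_ideal ideal_I ideal_J)

definition restr :: "(expo + expo \<Rightarrow> 'k) \<Rightarrow> expo \<Rightarrow> 'k" where
  "restr w = (\<lambda>a. if a \<in> K then w (Inl a) else 0)"

lemma restr_vecs: "w \<in> vecs S \<Longrightarrow> restr w \<in> vecs (K - I)"
  unfolding restr_def by (rule vecsI) (auto simp: vecs_def)

text \<open>One representative per basis element of \<open>M\<close>: of two identified monomials,
  the one in \<open>S/J\<close>.\<close>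

definition R :: "(expo + expo) set" where "R = Inl ` (- K) \<union> Inr ` (- J)"

text \<open>Normal form of a vector modulo the identifications \<open>(f, 0) \<sim> (0, phi f)\<close>:
  the part in \<open>K/I\<close> is moved to the second summand.\<close>

definition red :: "(expo + expo \<Rightarrow> 'k) \<Rightarrow> expo + expo \<Rightarrow> 'k" where
  "red w = pairv (\<lambda>a. if a \<in> K then 0 else w (Inl a)) (\<lambda>b. w (Inr b) + phi (restr w) b)"

lemma R_S: "R \<subseteq> S"
  unfolding R_def Sbasis_def using I_K by auto

lemma finite_R: "finite R"
  unfolding R_def using fin_J finite_subset[OF _ fin_I, of "- K"] I_K by auto

lemma red_vecs:
  assumes w: "w \<in> vecs S" shows "red w \<in> vecs R"
proof (rule vecsI)
  fix s assume s: "s \<notin> R"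
  show "red w s = 0"
  proof (cases s)
    case (Inr b)
    then have "b \<in> J" using s by (auto simp: R_def)
    then show ?thesis
      using Inr vecsD[OF w, of "Inr b"] vecsD[OF phi_vecs[OF restr_vecs[OF w]], of b] by (simp add: red_def)
  qed (use s in \<open>auto simp: R_def red_def\<close>)
qed

lemma red_add:
  assumes "u \<in> vecs S" "w \<in> vecs S"
  shows "red (\<lambda>s. u s + w s) = (\<lambda>s. red u s + red w s)"
proof -
  have "restr (\<lambda>s. u s + w s) = (\<lambda>a. restr u a + restr w a)" by (auto simp: restr_def)
  then have "phi (restr (\<lambda>s. u s + w s)) = (\<lambda>b. phi (restr u) b + phi (restr w) b)"
    using phi_add restr_vecs assms by simp
  then show ?thesis unfolding red_def by (auto simp: pairv_def fun_eq_iff split: sum.split)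
qed

lemma red_scale:
  assumes "w \<in> vecs S"
  shows "red (\<lambda>s. c * w s) = (\<lambda>s. c * red w s)"
proof -
  have "restr (\<lambda>s. c * w s) = (\<lambda>a. c * restr w a)" by (auto simp: restr_def)
  then have "phi (restr (\<lambda>s. c * w s)) = (\<lambda>b. c * phi (restr w) b)"
    using phi_scale restr_vecs assms by simp
  then show ?thesis unfolding red_def by (auto simp: pairv_def fun_eq_iff algebra_simps split: sum.split)
qed

lemma red_diff:
  assumes "u \<in> vecs S" "w \<in> vecs S"
  shows "red (\<lambda>s. u s - w s) = (\<lambda>s. red u s - red w s)"
  using red_add[OF assms(1) vecs_scale[OF assms(2)], of "- 1"] red_scale[OF assms(2), of "- 1"] by simp

lemma red_id:
  assumes "w \<in> vecs R" shows "red w = w"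
proof -
  have Inl: "w (Inl a) = 0" if "a \<in> K" for a using vecsD[OF assms, of "Inl a"] that by (auto simp: R_def)
  then have "restr w = (\<lambda>_. 0)" by (auto simp: restr_def)
  then show ?thesis unfolding red_def using Inl by (intro pairv_eqI[symmetric]) (auto simp: phi_zero)
qed

abbreviation "U \<equiv> Usub I J K phi"

definition glue :: "(expo \<Rightarrow> 'k) \<Rightarrow> expo + expo \<Rightarrow> 'k" where
  "glue f = pairv f (\<lambda>b. - phi f b)"

lemma shift_glue:
  assumes "f \<in> vecs (K - I)" shows "shift a (glue f) = glue (smul I a f)"
  using assms unfolding shift_def glue_def by (simp add: smul_uminus phi_smul)

text \<open>As \<open>phi\<close> is S-linear, the generators \<open>glue f\<close> already form a
  submodule.\<close>

lemma U_eq: "U = glue ` vecs (K - I)"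
proof (intro equalityI subsetI)
  fix u assume "u \<in> U"
  then show "u \<in> glue ` vecs (K - I)"
    unfolding Usub_def
  proof (induction rule: submod_gen.induct)
    case (gen g)
    then show ?case by (auto simp: glue_def)
  next
    case zero
    have "(\<lambda>_. 0) = glue (\<lambda>_. 0)" unfolding glue_def by (rule pairv_eqI) (simp_all add: phi_zero)
    then show ?case using zero_vecs by blast
  next
    case (add u v)
    then obtain f g where "f \<in> vecs (K - I)" "g \<in> vecs (K - I)" "u = glue f" "v = glue g" by auto
    moreover from this have "(\<lambda>s. u s + v s) = glue (\<lambda>a. f a + g a)"
      unfolding glue_def by (intro pairv_eqI) (simp_all add: phi_add)
    ultimately show ?case using vecs_add by blast
  next
    case (smult u c)
    then obtain f where "f \<in> vecs (K - I)" "u = glue f" by auto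
    moreover from this have "(\<lambda>s. c * u s) = glue (\<lambda>a. c * f a)"
      unfolding glue_def by (intro pairv_eqI) (simp_all add: phi_scale)
    ultimately show ?case using vecs_scale by blast
  next
    case (mulx i u)
    then obtain f where f: "f \<in> vecs (K - I)" "u = glue f" by auto
    then have "Sop I J i u = glue (smul I (evar i) f)" by (simp add: Sop_eq_shift shift_glue)
    then show ?case using smul_vecs[OF ideal_K f(1)] by blast
  qed
qed (auto simp: Usub_def glue_def intro: submod_gen.gen)

lemma red_glue:
  assumes "f \<in> vecs (K - I)" shows "red (glue f) = (\<lambda>_. 0)"
proof -
  have "restr (glue f) = f" using vecsD[OF assms] by (auto simp: restr_def glue_def fun_eq_iff)
  then show ?thesis unfolding red_def glue_def
    using vecsD[OF assms] by (intro pairv_eqI[symmetric]) auto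
qed

lemma diff_red:
  assumes "w \<in> vecs S" shows "(\<lambda>s. w s - red w s) = glue (restr w)"
  unfolding red_def glue_def by (rule pairv_eqI) (auto simp: restr_def)

text \<open>\<open>red\<close> kills \<open>U\<close>, and \<open>w - red w\<close> lies in
  \<open>U\<close>, so the classes are the fibres of \<open>red\<close>.\<close>

lemma mem_Mcls:
  assumes w: "w \<in> vecs S"
  shows "w' \<in> Mcls I J K phi w \<longleftrightarrow> w' \<in> vecs S \<and> red w' = red w"
proof (cases "w' \<in> vecs S")
  case w': True
  have "(\<lambda>s. w' s - w s) \<in> U \<longleftrightarrow> red w' = red w"
  proof
    assume "(\<lambda>s. w' s - w s) \<in> U"
    then have "red (\<lambda>s. w' s - w s) = (\<lambda>_. 0)" using red_glue by (auto simp: U_eq)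
    then show "red w' = red w" using red_diff[OF w' w] by (simp add: fun_eq_iff)
  next
    assume "red w' = red w"
    then have "(\<lambda>s. w' s - w s) = (\<lambda>s. (w' s - red w' s) - (w s - red w s))" by simp
    also have "\<dots> = (\<lambda>s. glue (restr w') s - glue (restr w) s)"
      using diff_red[OF w] diff_red[OF w'] by (simp add: fun_eq_iff)
    also have "\<dots> = (\<lambda>s. glue (restr w') s + - 1 * glue (restr w) s)" by simp
    also have "\<dots> \<in> U" unfolding Usub_def
      by (intro submod_gen.add submod_gen.smult submod_gen.gen)
        (use restr_vecs w w' in \<open>auto simp: glue_def\<close>)
    finally show "(\<lambda>s. w' s - w s) \<in> U" .
  qed
  then show ?thesis using w' unfolding Mcls_def by simp
qed (simp add: Mcls_def)

lemma Mcls_eq_iff: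
  assumes "w \<in> vecs S" "w' \<in> vecs S"
  shows "Mcls I J K phi w = Mcls I J K phi w' \<longleftrightarrow> red w = red w'"
  using assms mem_Mcls by (auto simp: set_eq_iff)

text \<open>\<open>w - red w\<close> lies in \<open>U\<close>, which shifts preserve and
  \<open>red\<close> kills. Hence the action on \<open>M\<close> can be computed on normal
  forms.\<close>

lemma red_shift_red:
  assumes w: "w \<in> vecs S"
  shows "red (shift a (red w)) = red (shift a w)"
proof -
  have "red (shift a (\<lambda>s. w s - red w s)) = (\<lambda>_. 0)"
    unfolding diff_red[OF w]
    by (simp add: shift_glue restr_vecs[OF w] red_glue smul_vecs[OF ideal_K])
  then show ?thesis
    by (simp add: shift_diff red_diff shift_vecs fun_eq_iff)
qed

section \<open>The monomial basis and the matrices of monomials\<close>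

definition cl :: "expo + expo \<Rightarrow> (expo + expo \<Rightarrow> 'k) set" where
  "cl r = Mcls I J K phi (delta r)"

abbreviation "MB \<equiv> Mbasis I J K phi"

lemma delta_S: "r \<in> R \<Longrightarrow> delta r \<in> vecs S"
  using R_S by (auto intro: delta_vecs)

lemma red_delta: "r \<in> R \<Longrightarrow> red (delta r) = delta r"
  by (rule red_id[OF delta_vecs])

lemma inj_cl: "inj_on cl R"
  by (rule inj_onI) (metis Mcls_eq_iff cl_def delta_S delta_eq_iff red_delta)

lemma Mbasis_eq: "MB = cl ` R"
proof (intro equalityI subsetI)
  fix \<beta> assume "\<beta> \<in> MB"
  then consider a where "a \<notin> I" "\<beta> = cl (Inl a)" | b where "b \<notin> J" "\<beta> = cl (Inr b)"
    unfolding Mbasis_def cl_def by blast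
  then show "\<beta> \<in> cl ` R"
  proof cases
    case (1 a)
    show ?thesis
    proof (cases "a \<in> K")
      \<comment> \<open>A monomial of \<open>K - I\<close> has the normal form
        \<open>delta (Inr (\<sigma> a))\<close>, so it adds no new class.\<close>
      case True
      then have a: "a \<in> K - I" using 1 by simp
      have "restr (delta (Inl a)) = delta a" using True by (auto simp: restr_def delta_def fun_eq_iff)
      then have "red (delta (Inl a)) = delta (Inr (\<sigma> a))"
        unfolding red_def using \<sigma>(2)[OF a] True
        by (intro pairv_eqI[symmetric]) (auto simp: delta_def)
      moreover have R: "Inr (\<sigma> a) \<in> R" using \<sigma>(1)[OF a] by (auto simp: R_def)
      ultimately have "cl (Inl a) = cl (Inr (\<sigma> a))"
        unfolding cl_def using red_delta[OF R] delta_S[OF R] 1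
        by (subst Mcls_eq_iff) (auto intro: delta_vecs)
      then show ?thesis using 1 R by blast
    qed (use 1 in \<open>auto simp: R_def\<close>)
  qed (auto simp: R_def)
qed (use I_K in \<open>auto simp: Mbasis_def cl_def R_def\<close>)

text \<open>\<open>R\<close> has as many elements as \<open>- K\<close> and \<open>- J\<close>
  together, and \<open>K - I\<close> is what \<open>- I\<close> has beyond
  \<open>- K\<close>.\<close>

lemma card_Mbasis: "card MB + card (K - I) = card (- I) + card (- J)"
proof -
  have fK: "finite (- K)" "finite (K - I)" by (rule finite_subset[OF _ fin_I], use I_K in auto)+
  have "card MB = card R" unfolding Mbasis_eq by (rule card_image[OF inj_cl])
  also have "\<dots> = card (- K) + card (- J)"
    unfolding R_def using fK fin_J by (subst card_Un_disjoint) (auto simp: card_image)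
  finally have "card MB = card (- K) + card (- J)" .
  moreover have "card (- I) = card (- K) + card (K - I)"
  proof -
    have "- I = - K \<union> (K - I)" "- K \<inter> (K - I) = {}" using I_K by auto
    then show ?thesis using card_Un_disjoint[OF fK] by argo
  qed
  ultimately show ?thesis by simp
qed

definition ri :: "(expo + expo \<Rightarrow> 'k) set \<Rightarrow> expo + expo" where
  "ri = inv_into R cl"

lemma ri_cl [simp]: "r \<in> R \<Longrightarrow> ri (cl r) = r"
  unfolding ri_def by (rule inv_into_f_f[OF inj_cl])

text \<open>The matrix of \<open>x^a\<close> on \<open>M\<close>, read off from normal forms; it is
  zero outside the basis, as \<open>is_mult_matrix\<close> demands.\<close>

definition Mon :: "expo \<Rightarrow> (expo + expo \<Rightarrow> 'k) set \<Rightarrow> (expo + expo \<Rightarrow> 'k) set \<Rightarrow> 'k" where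
  "Mon a \<beta> \<gamma> = (if \<beta> \<in> MB \<and> \<gamma> \<in> MB then red (shift a (delta (ri \<gamma>))) (ri \<beta>) else 0)"

lemma Mon_cl: "r \<in> R \<Longrightarrow> r' \<in> R \<Longrightarrow> Mon a (cl r') (cl r) = red (shift a (delta r)) r'"
  by (simp add: Mon_def Mbasis_eq)

text \<open>\<open>is_mult_matrix\<close> speaks of classes of combinations of chosen
  representatives. Applying \<open>red\<close> turns each representative into a unit vector, so the
  entries are forced to be the coordinates of a normal form.\<close>

lemma mult_matrix_eq_Mon:
  assumes A: "is_mult_matrix I J K phi i A"
  shows "A = Mon (evar i)"
proof (intro ext)
  fix \<beta> \<gamma>
  show "A \<beta> \<gamma> = Mon (evar i) \<beta> \<gamma>"
  proof (cases "\<beta> \<in> MB \<and> \<gamma> \<in> MB")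
    case True
    then obtain r r' where r: "r \<in> R" "\<gamma> = cl r" "r' \<in> R" "\<beta> = cl r'" by (auto simp: Mbasis_eq)
    define rep :: "(expo + expo \<Rightarrow> 'k) set \<Rightarrow> expo + expo \<Rightarrow> 'k" where "rep \<beta> = (SOME v. v \<in> \<beta>)" for \<beta>
    have rep: "rep \<beta> \<in> vecs S \<and> red (rep \<beta>) = delta (ri \<beta>)" if \<beta>: "\<beta> \<in> MB" for \<beta>
    proof -
      obtain t where t: "t \<in> R" "\<beta> = cl t" using \<beta> by (auto simp: Mbasis_eq)
      have iff: "w \<in> \<beta> \<longleftrightarrow> w \<in> vecs S \<and> red w = delta t" for w
        using mem_Mcls[OF delta_S[OF t(1)]] red_delta[OF t(1)] t by (simp add: cl_def)
      then have "delta t \<in> \<beta>" using delta_S[OF t(1)] red_delta[OF t(1)] by simp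
      then have "rep \<beta> \<in> \<beta>" unfolding rep_def by (rule someI[where P = "\<lambda>v. v \<in> \<beta>"])
      then show ?thesis using iff t by simp
    qed
    have fMB: "finite MB" unfolding Mbasis_eq using finite_R by simp
    have "delta r \<in> \<gamma>"
      unfolding r cl_def mem_Mcls[OF delta_S[OF r(1)]] using delta_S[OF r(1)] by simp
    then have "Mcls I J K phi (shift (evar i) (delta r)) =
        Mcls I J K phi (\<lambda>s. \<Sum>\<beta>\<in>MB. A \<beta> \<gamma> * rep \<beta> s)"
      using A True unfolding is_mult_matrix_def rep_def Sop_eq_shift by blast
    then have "red (shift (evar i) (delta r)) = red (\<lambda>s. \<Sum>\<beta>\<in>MB. A \<beta> \<gamma> * rep \<beta> s)"
      by (subst (asm) Mcls_eq_iff) (use rep in \<open>auto intro: shift_vecs vecs_sum\<close>)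
    also have "\<dots> = (\<lambda>s. \<Sum>\<beta>\<in>MB. A \<beta> \<gamma> * red (rep \<beta>) s)"
      by (rule linear_sum[where B = S]) (use fMB rep red_add red_scale in auto)
    finally have "red (shift (evar i) (delta r)) r' = (\<Sum>\<beta>\<in>MB. A \<beta> \<gamma> * delta (ri \<beta>) r')"
      using rep by simp
    also have "\<dots> = (\<Sum>t\<in>R. A (cl t) \<gamma> * delta t r')"
      unfolding Mbasis_eq by (simp add: sum.reindex[OF inj_cl])
    also have "\<dots> = A \<beta> \<gamma>"
      using finite_R r by (simp add: delta_def if_distrib[of "\<lambda>x. _ * x"] cong: if_cong)
    finally show ?thesis using r by (simp add: Mon_cl)
  next
    case False
    then show ?thesis using A unfolding is_mult_matrix_def Mon_def by auto
  qed
qed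

lemma Mon_zero: "Mon (0, 0, 0) = mone MB"
proof (intro ext)
  fix \<beta> \<gamma>
  show "Mon (0, 0, 0) \<beta> \<gamma> = mone MB \<beta> \<gamma>"
  proof (cases "\<beta> \<in> MB \<and> \<gamma> \<in> MB")
    case True
    then obtain r r' where r: "r \<in> R" "\<gamma> = cl r" "r' \<in> R" "\<beta> = cl r'" by (auto simp: Mbasis_eq)
    then have "Mon (0, 0, 0) \<beta> \<gamma> = delta r r'"
      by (simp add: Mon_cl shift_one delta_S red_delta)
    then show ?thesis
      using True r inj_on_eq_iff[OF inj_cl] by (auto simp: delta_def mone_def)
  qed (auto simp: Mon_def mone_def)
qed

lemma Mon_ideal: "a \<in> I \<inter> J \<Longrightarrow> Mon a = (\<lambda>_ _. 0)"
  using red_id[OF zero_vecs] by (auto simp: fun_eq_iff Mon_def shift_zero)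

text \<open>Summing over the basis reassembles the normal form of \<open>x^b\<close> times a basis
  vector before \<open>x^a\<close> acts; \<open>red_shift_red\<close> removes the intermediate
  reduction.\<close>

lemma Mon_mult: "mmul MB (Mon a) (Mon b) = Mon (eadd a b)"
proof (intro ext)
  fix \<beta> \<gamma>
  show "mmul MB (Mon a) (Mon b) \<beta> \<gamma> = Mon (eadd a b) \<beta> \<gamma>"
  proof (cases "\<beta> \<in> MB \<and> \<gamma> \<in> MB")
    case True
    then obtain r r' where r: "r \<in> R" "\<gamma> = cl r" "r' \<in> R" "\<beta> = cl r'" by (auto simp: Mbasis_eq)
    define x where "x = red (shift b (delta r))"
    have x: "x \<in> vecs R" unfolding x_def by (rule red_vecs[OF shift_vecs])
    have "mmul MB (Mon a) (Mon b) \<beta> \<gamma> = (\<Sum>t\<in>R. Mon a \<beta> (cl t) * Mon b (cl t) \<gamma>)"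
      unfolding mmul_def Mbasis_eq by (simp add: sum.reindex[OF inj_cl])
    also have "\<dots> = (\<Sum>t\<in>R. x t * red (shift a (delta t)) r')"
      using r by (intro sum.cong) (simp_all add: Mon_cl x_def)
    also have "\<dots> = red (shift a (\<lambda>s. \<Sum>t\<in>R. x t * delta t s)) r'"
      by (subst linear_sum[where B = R and T = "\<lambda>w. red (shift a w)"])
        (auto simp: shift_add shift_scale red_add red_scale shift_vecs finite_R delta_vecs)
    also have "\<dots> = red (shift a x) r'" using vecs_expand[OF finite_R x] by simp
    also have "\<dots> = red (shift (eadd a b) (delta r)) r'"
      unfolding x_def by (simp add: red_shift_red shift_vecs shift_shift)
    finally show ?thesis using r by (simp add: Mon_cl)
  next
    case False
    then show ?thesis by (auto simp: mmul_def Mon_def)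
  qed
qed

text \<open>The matrices \<open>Mon a\<close> include the identity and are closed under products, so
  their span is an algebra; those with \<open>a \<in> I \<inter> J\<close> vanish.\<close>

lemma gen_alg_subset_span:
  assumes "G \<subseteq> range Mon"
  shows "gen_alg MB G \<subseteq> module.span mscale (Mon ` (- (I \<inter> J)))"
proof -
  interpret vs: vector_space "mscale :: 'k \<Rightarrow> ((expo + expo \<Rightarrow> 'k) set \<Rightarrow> (expo + expo \<Rightarrow> 'k) set \<Rightarrow> 'k) \<Rightarrow> _"
    by (rule vector_space_mscale)
  let ?W = "Mon ` (- (I \<inter> J))"
  have zero: "(\<lambda>_ _. 0) = (0 :: (expo + expo \<Rightarrow> 'k) set \<Rightarrow> (expo + expo \<Rightarrow> 'k) set \<Rightarrow> 'k)"
    by (simp add: fun_eq_iff)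
  have Mon: "Mon a \<in> vs.span ?W" for a
  proof (cases "a \<in> I \<inter> J")
    case True
    then show ?thesis using vs.span_zero by (simp add: Mon_ideal zero)
  qed (auto intro: vs.span_base)
  have mmul_span: "mmul MB P Q \<in> vs.span ?W" if P: "P \<in> vs.span ?W" and Q: "Q \<in> vs.span ?W" for P Q
  proof -
    \<comment> \<open>Bilinearity in two rounds: the left factor is first a single
      \<open>Mon a\<close>, then any element of the span.\<close>
    have left: "mmul MB (Mon a) Q \<in> vs.span ?W" for a
      using Q
    proof (induction rule: vs.span_induct_alt)
      case base
      then show ?case using vs.span_zero by (simp add: mmul_def zero)
    next
      case (step c x y)
      have "mmul MB (Mon a) (mscale c x + y) = mscale c (mmul MB (Mon a) x) + mmul MB (Mon a) y"
        by (simp add: fun_eq_iff mmul_def mscale_def sum.distrib sum_distrib_left algebra_simps)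
      moreover have "mmul MB (Mon a) x \<in> vs.span ?W" using step(1) Mon Mon_mult by (metis imageE)
      ultimately show ?case using step(2) vs.span_add vs.span_scale by metis
    qed
    show ?thesis using P
    proof (induction rule: vs.span_induct_alt)
      case base
      then show ?case using vs.span_zero by (simp add: mmul_def zero)
    next
      case (step c x y)
      have "mmul MB (mscale c x + y) Q = mscale c (mmul MB x Q) + mmul MB y Q"
        by (simp add: fun_eq_iff mmul_def mscale_def sum.distrib sum_distrib_left algebra_simps)
      moreover have "mmul MB x Q \<in> vs.span ?W" using step(1) left by auto
      ultimately show ?case using step(2) vs.span_add vs.span_scale by metis
    qed
  qed
  show ?thesis
  proof
    fix P assume "P \<in> gen_alg MB G"
    then show "P \<in> vs.span ?W"
    proof induction
      case one
      show ?case using Mon[of "(0, 0, 0)"] by (simp add: Mon_zero)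
    next
      case (gen P)
      then show ?case using assms Mon by auto
    next
      case (add P Q)
      then show ?case using vs.span_add[of P ?W Q] by (simp add: plus_fun_def)
    next
      case (smult P c)
      have "(\<lambda>x y. c * P x y) = mscale c P" by (simp add: mscale_def)
      then show ?case using vs.span_scale[OF smult(2), of c] by simp
    next
      case (mul P Q)
      then show ?case by (blast intro: mmul_span)
    qed
  qed
qed

lemma dim_gen_alg_le:
  assumes "\<forall>i<3. is_mult_matrix I J K phi i (A i)"
  shows "vector_space.dim mscale (gen_alg MB {A 0, A 1, A 2}) \<le> card (- (I \<inter> J))"
proof -
  interpret vs: vector_space "mscale :: 'k \<Rightarrow> ((expo + expo \<Rightarrow> 'k) set \<Rightarrow> (expo + expo \<Rightarrow> 'k) set \<Rightarrow> 'k) \<Rightarrow> _"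
    by (rule vector_space_mscale)
  have fin: "finite (- (I \<inter> J))" using fin_I fin_J by (simp add: Compl_Int)
  have "A i = Mon (evar i)" if "i < 3" for i using assms mult_matrix_eq_Mon that by blast
  then have "{A 0, A 1, A 2} \<subseteq> range Mon" by auto
  then have "vs.dim (gen_alg MB {A 0, A 1, A 2}) \<le> card (Mon ` (- (I \<inter> J)))"
    by (intro vs.dim_le_card gen_alg_subset_span) (use fin in auto)
  also have "\<dots> \<le> card (- (I \<inter> J))" by (rule card_image_le[OF fin])
  finally show ?thesis .
qed

end

section \<open>Annihilation by \<open>x_1\<close> and \<open>x_2\<close>, and the final
  count\<close>

lemma smod_iso_annihilator:
  fixes T :: "(expo \<Rightarrow> 'k::field) \<Rightarrow> ('c \<Rightarrow> 'k)" and v :: "expo \<Rightarrow> 'k"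
  assumes "monomial_ideal K" "smod_iso (K - I) (mulx I) C Y T" "i < 3"
    and "\<And>w. w \<in> vecs C \<Longrightarrow> Y i w = (\<lambda>_. 0)" and v: "v \<in> vecs (K - I)"
  shows "mulx I i v = (\<lambda>_. 0)"
proof -
  have T: "T u \<in> vecs C" "T (\<lambda>x. c * u x) = (\<lambda>y. c * T u y)" "T (mulx I i u) = Y i (T u)"
    if "u \<in> vecs (K - I)" for u c
    using assms(2,3) that unfolding smod_iso_def smod_hom_def by blast+
  have inj: "inj_on T (vecs (K - I))"
    using assms(2) unfolding smod_iso_def bij_betw_def by blast
  have "T (mulx I i v) = T (\<lambda>_. 0)"
    using T(2)[OF zero_vecs, of 0] T(1,3)[OF v] assms(4) by simp
  then show ?thesis
    unfolding mulx_eq_smul by (rule inj_onD[OF inj _ smul_vecs[OF assms(1) v] zero_vecs])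
qed

text \<open>The indices 0 and 1 stand for \<open>x_1\<close> and \<open>x_2\<close>, which are
  generators of every \<open>Pideal n\<close>.\<close>

lemma Nop_eq_zero:
  assumes "i < 2" shows "Nop ns i w = (\<lambda>_. 0)"
proof -
  have "b \<in> Pideal n" if "eadd a (evar i) = b" for a b n
    using assms that unfolding Pideal_def mon_ideal_gen_def evar_def
    by (auto simp: eadd_def less_2_cases_iff)
  then have empty: "{a. eadd a (evar i) = b} = {}" if "b \<notin> Pideal n" for b n using that by blast
  have "mulx (Pideal n) i v b = (0 :: 'a)" for n v b
  proof (cases "b \<in> Pideal n")
    case False
    then show ?thesis unfolding mulx_def empty[OF False] by simp
  qed (simp add: mulx_def)
  then show ?thesis by (auto simp: Nop_def fun_eq_iff)
qed

lemma annihilator_imp_mem: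
  assumes "mulx I i (delta a) = (\<lambda>_. 0 :: 'k::field)"
  shows "eadd a (evar i) \<in> I"
proof (rule ccontr)
  assume "\<not> ?thesis"
  then have "mulx I i (delta a) (eadd a (evar i)) = (1::'k)"
    by (simp add: mulx_eq_smul smul_eadd delta_def)
  then show False using assms by simp
qed

theorem theorem1p1:
  fixes I K J L :: "expo set"
    and phi :: "(expo \<Rightarrow> 'k::field) \<Rightarrow> (expo \<Rightarrow> 'k)"
    and A :: "nat \<Rightarrow> (expo + expo \<Rightarrow> 'k) set \<Rightarrow> (expo + expo \<Rightarrow> 'k) set \<Rightarrow> 'k"
  assumes "monomial_ideal I" and "monomial_ideal K"
    and "monomial_ideal J" and "monomial_ideal L"
    and "I \<subseteq> K" and "J \<subseteq> L"
    and "finite (- I)" and "finite (- J)"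
    and "\<exists>ns. ns \<noteq> [] \<and> (\<forall>n\<in>set ns. 0 < n) \<and>
           (\<exists>T :: (expo \<Rightarrow> 'k) \<Rightarrow> (nat \<times> expo \<Rightarrow> 'k). smod_iso (K - I) (mulx I) (Nbasis ns) (Nop ns) T)"
    and "smod_iso (K - I) (mulx I) (L - J) (mulx J) phi"
    and "\<forall>a\<in>K - I. \<exists>a'\<in>L - J. phi (delta a) = delta a'"
    and "\<forall>i<3. is_mult_matrix I J K phi i (A i)"
  shows "vector_space.dim mscale (gen_alg (Mbasis I J K phi) {A 0, A 1, A 2})
           \<le> card (Mbasis I J K phi)"
  (is "vector_space.dim _ ?A \<le> card ?B")
proof -
  interpret gluing I K J L phi by unfold_locales (use assms in auto)
  obtain ns and T :: "(expo \<Rightarrow> 'k) \<Rightarrow> (nat \<times> expo \<Rightarrow> 'k)"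
    where T: "smod_iso (K - I) (mulx I) (Nbasis ns) (Nop ns) T" using assms(9) by blast
  have annI: "mulx I i v = (\<lambda>_. 0)" if "i < 2" "v \<in> vecs (K - I)" for i and v :: "expo \<Rightarrow> 'k"
    by (rule smod_iso_annihilator[OF ideal_K T]) (use that Nop_eq_zero in auto)
  \<comment> \<open>Vanishing is carried over by \<open>phi\<close>, which is onto and commutes with
    the variables.\<close>
  have annJ: "mulx J i w = (\<lambda>_. 0)" if i: "i < 2" and w: "w \<in> vecs (L - J)" for i and w :: "expo \<Rightarrow> 'k"
  proof -
    obtain v where v: "v \<in> vecs (K - I)" "w = phi v" using phi_bij w by (auto simp: bij_betw_def)
    have "mulx J i w = phi (mulx I i v)" using phi_mulx[of i v] v i by (simp add: mulx_eq_smul)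
    then show ?thesis using annI[OF i v(1)] phi_zero by simp
  qed
  have memI: "eadd a (evar i) \<in> I" if "a \<in> K - I" "i < 2" for a i
    using annihilator_imp_mem annI[OF that(2) delta_vecs[OF that(1)]] by blast
  have memJ: "eadd a (evar i) \<in> J" if "a \<in> L - J" "i < 2" for a i
    using annihilator_imp_mem annJ[OF that(2) delta_vecs[OF that(1)]] by blast
  have "eadd a (1, 0, 0) \<in> I \<and> eadd a (0, 1, 0) \<in> I" if "a \<in> K - I" for a
    using memI[OF that, of 0] memI[OF that, of 1] by (simp add: evar_def)
  moreover have "eadd a (1, 0, 0) \<in> J \<and> eadd a (0, 1, 0) \<in> J" if "a \<in> L - J" for a
    using memJ[OF that, of 0] memJ[OF that, of 1] by (simp add: evar_def)
  ultimately have "card (K - I) \<le> card (- I \<inter> - J)"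
    by (rule card_socle_le[OF ideal_I ideal_K ideal_J ideal_L fin_I fin_J _ _ \<sigma>_bij \<sigma>_eadd])
  moreover have "card (- (I \<inter> J)) + card (- I \<inter> - J) = card (- I) + card (- J)"
    using card_Un_Int[OF fin_I fin_J] by (simp add: Compl_Int)
  \<comment> \<open>Both sides complete the total \<open>card (- I) + card (- J)\<close>: the left
    with \<open>card (- I \<inter> - J)\<close>, the right with \<open>card (K - I)\<close>.\<close>
  ultimately have "card (- (I \<inter> J)) \<le> card ?B" using card_Mbasis by linarith
  then show ?thesis using dim_gen_alg_le[OF assms(12)] by linarith
qed

end
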